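(* Let $M$ be a compact, connected $C^1$ manifold of finite dimension $m\ge 1$, with or without boundary. If $f$ is typical in $\mathcal C(M)$, or if $f$ is typical in $\mathcal H(M)$, then the set $\mathcal O_f$ of pseudo-physical measures for $f$ has empty interior in the set of all $f$-invariant Borel probability measures (endowed with the weak$^*$ topology).
   Context: A Riemannian structure is fixed on $M$; $\mathrm{dist}$ is the induced distance and $\mathrm{Leb}$ the induced volume measure. $\mathcal C(M)$ is the space of continuous maps $M\to M$ with the topology of $\rho(f,g)=\max_{x\in M}\mathrm{dist}(f(x),g(x))$; $\mathcal H(M)$ is the space of homeomorphisms of $M$ with the topology of $\rho_H(f,g)=\max\{\rho(f,g),\rho(f^{-1},g^{-1})\}$. A property holds for typical $f\in\mathcal C(M)$ (resp. $\mathcal H(M)$) if the set of maps having it contains a countable intersection of open dense subsets of that space. For $x\in M$, $p\omega(x)$ is the set of all weak$^*$ limits of convergent subsequences of $\left(\frac1n\sum_{j=0}^{n-1}\delta_{f^j(x)}\right)_{n\ge1}$. Let $d$ be a fixed distance inducing the weak$^*$ topology on the Borel probability measures of $M$, and $d(p\omega(x),\mu)=\inf_{\nu\in p\omega(x)}d(\nu,\mu)$. A probability measure $\mu$ is pseudo-physical for $f$ if for all $\varepsilon>0$ the set $A_\varepsilon(\mu)=\{x\in M: d(p\omega(x),\mu)<\varepsilon\}$ has positive Lebesgue measure (this does not depend on the choice of $d$). $\mathcal O_f$ is the set of pseudo-physical measures for $f$. *)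

theory Defs
  imports "HOL-Probability.Probability"
begin

section \<open>Compact manifolds of class C1 with a Riemannian structure\<close>

text \<open>
  The manifold is the whole type \<open>'a\<close>; its dimension is \<open>CARD('n)\<close>, hence at least 1.
  A chart is a pair of a domain and a coordinate map. Chart images are open in Euclidean space
  or relatively open in a closed half-space, so manifolds with boundary are covered.
\<close>

type_synonym ('a, 'n) chart = "'a set \<times> ('a \<Rightarrow> real ^ 'n)"

definition is_chart :: "('a::topological_space, 'n::finite) chart \<Rightarrow> bool" where
  "is_chart c \<longleftrightarrow> (case c of (U, \<phi>) \<Rightarrow>
     open U \<and> (\<exists>\<psi>. homeomorphism U (\<phi> ` U) \<phi> \<psi>) \<and>
     (open (\<phi> ` U) \<or> (\<exists>k. openin (top_of_set {y. 0 \<le> y $ k}) (\<phi> ` U))))"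

text \<open>
  A map on an arbitrary subset of Euclidean space is of class C1 if near every point of the subset
  it extends to a C1 map on an open set; this is what is needed at boundary points.
\<close>

definition C1_on :: "(real ^ 'n::finite) set \<Rightarrow> (real ^ 'n \<Rightarrow> real ^ 'n) \<Rightarrow> bool" where
  "C1_on S f \<longleftrightarrow> (\<forall>x\<in>S. \<exists>W h (h' :: real ^ 'n \<Rightarrow> (real ^ 'n) \<Rightarrow>\<^sub>L (real ^ 'n)).
     open W \<and> x \<in> W \<and> (\<forall>y\<in>S \<inter> W. h y = f y) \<and>
     (\<forall>y\<in>W. (h has_derivative blinfun_apply (h' y)) (at y)) \<and> continuous_on W h')"

definition transition :: "('a, 'n::finite) chart \<Rightarrow> ('a, 'n) chart \<Rightarrow> real ^ 'n \<Rightarrow> real ^ 'n" where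
  "transition c c' = snd c' \<circ> inv_into (fst c) (snd c)"

definition C1_atlas :: "('a::topological_space, 'n::finite) chart set \<Rightarrow> bool" where
  "C1_atlas \<A> \<longleftrightarrow>
     (\<forall>c\<in>\<A>. is_chart c) \<and> (\<Union>c\<in>\<A>. fst c) = UNIV \<and>
     (\<forall>c\<in>\<A>. \<forall>c'\<in>\<A>. C1_on (snd c ` (fst c \<inter> fst c')) (transition c c'))"

text \<open>
  In a \<open>riemannian_metric\<close>, the number \<open>g c p u v\<close> is the inner product of the two tangent
  vectors at \<open>p\<close> whose coordinates in the chart \<open>c\<close> are \<open>u\<close> and \<open>v\<close>; it is meaningful for \<open>p\<close> in
  the domain of \<open>c\<close>. On a C1 manifold the natural regularity of the tensor is continuity.
\<close>

type_synonym ('a, 'n) metric_tensor =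
  "('a, 'n) chart \<Rightarrow> 'a \<Rightarrow> real ^ 'n \<Rightarrow> real ^ 'n \<Rightarrow> real"

definition riemannian_metric ::
  "('a::topological_space, 'n::finite) chart set \<Rightarrow> ('a, 'n) metric_tensor \<Rightarrow> bool" where
  "riemannian_metric \<A> g \<longleftrightarrow>
     (\<forall>c\<in>\<A>. \<forall>p\<in>fst c. bilinear (g c p) \<and>
        (\<forall>u v. g c p u v = g c p v u) \<and> (\<forall>u. u \<noteq> 0 \<longrightarrow> 0 < g c p u u)) \<and>
     (\<forall>c\<in>\<A>. \<forall>u v. continuous_on (fst c) (\<lambda>p. g c p u v)) \<and>
     (\<forall>c\<in>\<A>. \<forall>c'\<in>\<A>. \<forall>p\<in>fst c \<inter> fst c'. \<forall>D.
        (transition c c' has_derivative D) (at (snd c p) within snd c ` (fst c \<inter> fst c')) \<longrightarrow>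
        (\<forall>u v. g c p u v = g c' p (D u) (D v)))"

definition C1_curve_on ::
  "('a::topological_space, 'n::finite) chart set \<Rightarrow> real \<Rightarrow> real \<Rightarrow> (real \<Rightarrow> 'a) \<Rightarrow> bool" where
  "C1_curve_on \<A> a b \<gamma> \<longleftrightarrow> (\<forall>c\<in>\<A>. \<exists>\<gamma>'. let T = {t \<in> {a..b}. \<gamma> t \<in> fst c} in
     (\<forall>t\<in>T. ((snd c \<circ> \<gamma>) has_vector_derivative \<gamma>' t) (at t within T)) \<and> continuous_on T \<gamma>')"

text \<open>The finite set \<open>F\<close> consists of the points of a subdivision of the unit interval.\<close>

definition piecewise_C1_curve ::
  "('a::topological_space, 'n::finite) chart set \<Rightarrow> (real \<Rightarrow> 'a) \<Rightarrow> bool" where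
  "piecewise_C1_curve \<A> \<gamma> \<longleftrightarrow> path \<gamma> \<and>
     (\<exists>F. finite F \<and> {0, 1} \<subseteq> F \<and> F \<subseteq> {0..1} \<and>
        (\<forall>a\<in>F. \<forall>b\<in>F. a < b \<and> F \<inter> {a<..<b} = {} \<longrightarrow> C1_curve_on \<A> a b \<gamma>))"

text \<open>
  The speed does not depend on the chart used to compute it. It is well defined outside the
  finitely many subdivision points, whose values are irrelevant for the length.
\<close>

definition speed ::
  "('a::topological_space, 'n::finite) chart set \<Rightarrow> ('a, 'n) metric_tensor \<Rightarrow>
     (real \<Rightarrow> 'a) \<Rightarrow> real \<Rightarrow> real" where
  "speed \<A> g \<gamma> t = (THE s. \<exists>c\<in>\<A>. \<gamma> t \<in> fst c \<and>
     (\<exists>v. ((snd c \<circ> \<gamma>) has_vector_derivative v) (at t) \<and> s = sqrt (g c (\<gamma> t) v v)))"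

definition curve_length ::
  "('a::topological_space, 'n::finite) chart set \<Rightarrow> ('a, 'n) metric_tensor \<Rightarrow>
     (real \<Rightarrow> 'a) \<Rightarrow> real" where
  "curve_length \<A> g \<gamma> = integral {0..1} (speed \<A> g \<gamma>)"

text \<open>
  The Riemannian distance of a connected manifold induces the topology of the manifold. A Riemannian
  manifold is therefore taken to be a type in \<open>metric_space\<close> whose \<open>dist\<close> equals \<open>riemannian_dist\<close>.
\<close>

definition riemannian_dist ::
  "('a::topological_space, 'n::finite) chart set \<Rightarrow> ('a, 'n) metric_tensor \<Rightarrow> 'a \<Rightarrow> 'a \<Rightarrow> real" where
  "riemannian_dist \<A> g x y =
     Inf {curve_length \<A> g \<gamma> |\<gamma>. piecewise_C1_curve \<A> \<gamma> \<and> pathstart \<gamma> = x \<and> pathfinish \<gamma> = y}"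

text \<open>
  The Riemannian volume is the unique Borel measure that has density \<open>sqrt (det g)\<close> with respect
  to Lebesgue measure in every chart.
\<close>

definition volume_density ::
  "('a, 'n::finite) metric_tensor \<Rightarrow> ('a, 'n) chart \<Rightarrow> 'a \<Rightarrow> real" where
  "volume_density g c p = sqrt (det (\<chi> i j. g c p (axis i 1) (axis j 1)))"

definition is_riemannian_volume ::
  "('a::topological_space, 'n::finite) chart set \<Rightarrow> ('a, 'n) metric_tensor \<Rightarrow> 'a measure \<Rightarrow> bool" where
  "is_riemannian_volume \<A> g vol \<longleftrightarrow> sets vol = sets borel \<and>
     (\<forall>c\<in>\<A>. \<forall>B\<in>sets borel. B \<subseteq> fst c \<longrightarrow>
        emeasure vol B =
          (\<integral>\<^sup>+y\<in>snd c ` B. ennreal (volume_density g c (inv_into (fst c) (snd c) y)) \<partial>lborel))"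


section \<open>Typical continuous maps and homeomorphisms\<close>

definition sup_dist :: "('a::metric_space \<Rightarrow> 'a) \<Rightarrow> ('a \<Rightarrow> 'a) \<Rightarrow> real" where
  "sup_dist f g = (SUP x. dist (f x) (g x))"

definition homeo_dist :: "('a::metric_space \<Rightarrow> 'a) \<Rightarrow> ('a \<Rightarrow> 'a) \<Rightarrow> real" where
  "homeo_dist f g = max (sup_dist f g) (sup_dist (inv f) (inv g))"

definition continuous_maps :: "('a::metric_space \<Rightarrow> 'a) topology" where
  "continuous_maps = Metric_space.mtopology {f. continuous_on UNIV f} sup_dist"

definition homeomorphisms :: "('a::metric_space \<Rightarrow> 'a) topology" where
  "homeomorphisms = Metric_space.mtopology {f. \<exists>h. homeomorphism UNIV UNIV f h} homeo_dist"

definition typical :: "'b topology \<Rightarrow> ('b \<Rightarrow> bool) \<Rightarrow> bool" where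
  "typical X P \<longleftrightarrow> (\<exists>\<G>. countable \<G> \<and>
     (\<forall>G\<in>\<G>. openin X G \<and> X closure_of G = topspace X) \<and>
     topspace X \<inter> \<Inter>\<G> \<subseteq> {f. P f})"


section \<open>Invariant and pseudo-physical measures\<close>

definition prob_measures :: "'a::topological_space measure set" where
  "prob_measures = {\<mu>. sets \<mu> = sets borel \<and> prob_space \<mu>}"

text \<open>
  On a compact space every continuous function is bounded, so the following is the coarsest
  topology that makes the integral of every continuous function continuous.
\<close>

definition weak_star :: "'a::topological_space measure topology" where
  "weak_star = topology_generated_by
     {{\<mu> \<in> prob_measures. integral\<^sup>L \<mu> f \<in> V} |(f :: 'a \<Rightarrow> real) V. continuous_on UNIV f \<and> open V}"

definition invariant_measures :: "('a::topological_space \<Rightarrow> 'a) \<Rightarrow> 'a measure set" where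
  "invariant_measures f = {\<mu> \<in> prob_measures. \<forall>B\<in>sets borel. emeasure \<mu> (f -` B) = emeasure \<mu> B}"

text \<open>
  The average of the point masses at the first \<open>n\<close> points of the orbit, as the image of the
  uniform distribution on \<open>{..<n}\<close>; see \<open>emeasure_empirical_measure\<close> below.
\<close>

definition empirical_measure :: "('a::topological_space \<Rightarrow> 'a) \<Rightarrow> 'a \<Rightarrow> nat \<Rightarrow> 'a measure" where
  "empirical_measure f x n = distr (uniform_count_measure {..<n}) borel (\<lambda>j. (f ^^ j) x)"

lemma emeasure_empirical_measure:
  assumes "0 < n" and B: "B \<in> sets borel"
  shows "emeasure (empirical_measure f x n) B =
    ennreal ((\<Sum>j<n. measure (return borel ((f ^^ j) x)) B) / real n)"
proof -
  have "emeasure (empirical_measure f x n) B =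
      emeasure (uniform_count_measure {..<n}) {j \<in> {..<n}. (f ^^ j) x \<in> B}"
    unfolding empirical_measure_def
    by (subst emeasure_distr)
      (auto simp: B space_uniform_count_measure measurable_def sets_uniform_count_measure
        intro!: arg_cong[where f = "emeasure _"])
  also have "\<dots> = ennreal (real (card {j \<in> {..<n}. (f ^^ j) x \<in> B}) / real n)"
    by (subst emeasure_uniform_count_measure) auto
  also have "real (card {j \<in> {..<n}. (f ^^ j) x \<in> B}) =
      (\<Sum>j<n. indicator B ((f ^^ j) x))"
    by (simp add: indicator_def sum.If_cases Int_def)
  finally show ?thesis
    using B by (simp add: measure_return)
qed

definition p_omega :: "('a::topological_space \<Rightarrow> 'a) \<Rightarrow> 'a \<Rightarrow> 'a measure set" where
  "p_omega f x = {\<nu>. \<exists>r. strict_mono r \<and> 0 < r 0 \<and>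
     limitin weak_star (\<lambda>k. empirical_measure f x (r k)) \<nu> sequentially}"

definition basin ::
  "('a::topological_space measure \<Rightarrow> 'a measure \<Rightarrow> real) \<Rightarrow> ('a \<Rightarrow> 'a) \<Rightarrow> real \<Rightarrow> 'a measure \<Rightarrow> 'a set"
  where "basin d f \<epsilon> \<mu> = {x. (INF \<nu>\<in>p_omega f x. d \<nu> \<mu>) < \<epsilon>}"

definition pseudo_physical ::
  "'a::topological_space measure \<Rightarrow> ('a measure \<Rightarrow> 'a measure \<Rightarrow> real) \<Rightarrow> ('a \<Rightarrow> 'a) \<Rightarrow> 'a measure set"
  where "pseudo_physical vol d f =
    {\<mu> \<in> prob_measures. \<forall>\<epsilon>>0. 0 < emeasure vol (basin d f \<epsilon> \<mu>)}"

end

theory Submission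
  imports Defs
begin

text \<open>
  The basins of a pseudo-physical measure have positive volume and are therefore not empty, so for
  every radius there is a single orbit whose limit measures come that close. What excludes measures is
  a dichotomy for single orbits. Suppose that \<open>f ^^ n\<close> maps a closed set \<open>B\<close> into an open set
  \<open>W \<subseteq> B\<close>, and let \<open>C\<close> be the union of the first \<open>n\<close> images of \<open>B\<close>. An orbit that meets
  \<open>W\<close> stays in \<open>C\<close> from then on, and every other orbit never meets \<open>W\<close>. Hence each measure in
  \<open>p_omega f x\<close> gives mass 0 to the complement of \<open>C\<close> or to \<open>W\<close>, and this survives the
  limit that leads to a pseudo-physical measure (\<open>pseudo_physical_zero_one\<close>). If some invariant
  measure charges \<open>W\<close> and some invariant measure charges the complement of \<open>C\<close>, then mixing an
  arbitrarily small proportion of both into any invariant measure destroys pseudo-physicality, so the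
  pseudo-physical measures have empty interior (\<open>pseudo_physical_empty_interior\<close>).

  Invariant measures come from the Krylov-Bogoliubov argument: \<open>p_omega f x\<close> is not empty
  (\<open>p_omega_nonempty\<close>) and consists of invariant measures (\<open>p_omega_invariant\<close>). An attracting
  block therefore always carries an invariant measure that charges \<open>W\<close>. The second measure is found
  in another attracting block that avoids \<open>C\<close> when \<open>f\<close> is only continuous
  (\<open>two_disjoint_blocks_empty_interior\<close>); when \<open>f\<close> is a homeomorphism, it is enough that \<open>C\<close> is
  not the whole space, because a backward orbit that starts outside \<open>C\<close> never enters the images of
  \<open>W\<close>
  (\<open>proper_block_empty_interior\<close>).

  Having such blocks is an open condition, as it says that finitely many iterates map compact sets
  into open sets. It is also dense, so one open dense set of maps suffices for typicality. For
  continuous maps, recurrence gives a periodic pseudo-orbit; it is doubled into two pseudo-orbits with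
  pairwise distinct points, and the map is made constant near each point, equal to the next
  one (\<open>dense_two_disjoint_blocks\<close>). For homeomorphisms this is impossible, and in dimension 1
  points cannot even be moved past each other. There one takes a point \<open>y\<close> whose first return to a
  small coordinate cell occurs at time \<open>n\<close> and composes the map with a homeomorphism that is
  supported in the cell and squeezes a neighbourhood of \<open>y\<close> and of its return into a tiny ball
  about \<open>y\<close>; since the return is the first one, the orbit segment before it is not disturbed
  (\<open>dense_proper_block\<close>). Return cells are met in points with Euclidean neighbourhoods, which a
  homeomorphism preserves, and this keeps the boundary of the manifold out of the construction.
\<close>

section \<open>A compact metric space as a continuous image of a compact set of reals\<close>

text \<open>
  Binary sequences are coded by reals of the Cantor set, scaled by the factor \<open>3/2\<close>; leaving out one
  of the three digits makes the code injective.
\<close>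

definition ternary :: "(nat \<Rightarrow> bool) \<Rightarrow> real" where
  "ternary a = (\<Sum>i. of_bool (a i) * (1/3) ^ i)"

lemma summable_ternary: "summable (\<lambda>i. of_bool (a i) * (1/3::real) ^ i)"
  by (rule summable_comparison_test[of _ "\<lambda>i. (1/3::real) ^ i"]) (auto intro!: exI[of _ 0])

lemma continuous_on_ternary: "continuous_on UNIV ternary"
proof -
  have cb: "continuous_on UNIV (\<lambda>b::bool. of_bool b :: real)"
    by simp
  have "uniform_limit UNIV (\<lambda>n a. \<Sum>i<n. of_bool (a i) * (1/3::real) ^ i) ternary sequentially"
    unfolding ternary_def
    by (rule Weierstrass_m_test[where M = "\<lambda>i. (1/3::real) ^ i"]) auto
  moreover have "continuous_on UNIV (\<lambda>a. \<Sum>i<n. of_bool (a i) * (1/3::real) ^ i)" for n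
    by (intro continuous_intros continuous_on_compose2[OF cb] continuous_on_product_coordinates) auto
  ultimately show ?thesis
    by (intro uniform_limit_theorem[where F = sequentially]) auto
qed

text \<open>
  At the first index \<open>k\<close> where two sequences differ, the code jumps by \<open>(1/3) ^ k\<close>, and all later
  digits together can make up for only half of this.
\<close>

lemma inj_ternary: "inj ternary"
proof -
  have ne: "ternary a \<noteq> ternary b" if k: "a k" "\<not> b k" and eq: "\<And>i. i < k \<Longrightarrow> a i = b i" for a b k
  proof -
    let ?f = "\<lambda>i. (of_bool (a i) - of_bool (b i)) * (1/3::real) ^ i"
    have f: "summable ?f"
      using summable_diff[OF summable_ternary[of a] summable_ternary[of b]]
      by (simp add: left_diff_distrib)
    have "ternary a - ternary b = suminf ?f"
      unfolding ternary_def
      by (subst suminf_diff[OF summable_ternary summable_ternary]) (simp add: left_diff_distrib)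
    also have "\<dots> = (\<Sum>i. ?f (i + Suc k)) + (\<Sum>i<Suc k. ?f i)"
      by (rule suminf_split_initial_segment[OF f])
    also have "(\<Sum>i<Suc k. ?f i) = (1/3) ^ k"
      using k eq by simp
    also have "(\<Sum>i. ?f (i + Suc k)) \<ge> (\<Sum>i. - ((1/3) ^ Suc k) * (1/3::real) ^ i)"
    proof (rule suminf_le)
      show "- ((1/3) ^ Suc k) * (1/3::real) ^ i \<le> ?f (i + Suc k)" for i
        by (auto simp: power_add)
      show "summable (\<lambda>i. - ((1/3) ^ Suc k) * (1/3::real) ^ i)"
        by (intro summable_mult summable_geometric) simp
      show "summable (\<lambda>i. ?f (i + Suc k))"
        using f by (rule summable_ignore_initial_segment)
    qed
    then have "(\<Sum>i. ?f (i + Suc k)) \<ge> - ((1/3) ^ k) / 2"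
      by (subst (asm) suminf_mult) (simp_all add: suminf_geometric)
    then have "(\<Sum>i. ?f (i + Suc k)) + (1/3) ^ k > 0"
      using zero_less_power[of "1/3::real" k] by linarith
    finally show ?thesis by auto
  qed
  show ?thesis
  proof (rule injI, rule ccontr)
    fix a b assume eq: "ternary a = ternary b" and "a \<noteq> b"
    then obtain k where k: "a k \<noteq> b k" "\<And>i. i < k \<Longrightarrow> a i = b i"
      using exists_least_iff[of "\<lambda>k. a k \<noteq> b k"] by blast
    then show False
      using ne[of a k b] ne[of b k a] eq by metis
  qed
qed

lemma compact_UNIV_nat_bool: "compact (UNIV :: (nat \<Rightarrow> bool) set)"
proof -
  have "compact_space (product_topology (\<lambda>i::nat. euclidean :: bool topology) UNIV)"
    by (subst compact_space_product_topology) (simp add: compact_space_def finite_imp_compact)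
  then show ?thesis
    by (simp add: euclidean_product_topology compact_space_def)
qed

text \<open>
  A binary sequence whose \<open>i\<close>-th entry selects one of the closed sets \<open>F i\<close> and \<open>G i\<close> is an
  address. Every point has an address because the two sets cover the space, and no address belongs to
  two points. The sets are a ball and the complement of a concentric smaller ball, for the centres and
  radii of finite covers by smaller and smaller balls.
\<close>

lemma compact_metric_separating_covers:
  assumes "compact (UNIV :: 'a::metric_space set)"
  obtains F G :: "nat \<Rightarrow> 'a::metric_space set" where
    "\<And>i. closed (F i)" "\<And>i. closed (G i)" "\<And>i. F i \<union> G i = UNIV"
    "\<And>x y. x \<noteq> y \<Longrightarrow> \<exists>i. x \<notin> G i \<and> y \<notin> F i"
proof -
  have "\<forall>n::nat. \<exists>C. finite C \<and> (UNIV::'a set) \<subseteq> (\<Union>q\<in>C. ball q (1 / (real n + 1)))"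
  proof
    fix n :: nat
    show "\<exists>C. finite C \<and> (UNIV::'a set) \<subseteq> (\<Union>q\<in>C. ball q (1 / (real n + 1)))"
    proof (rule compactE_image[OF assms, of UNIV "\<lambda>q. ball q (1 / (real n + 1))"])
      have "x \<in> ball x (1 / (real n + 1))" for x :: 'a by simp
      then show "(UNIV::'a set) \<subseteq> (\<Union>q. ball q (1 / (real n + 1)))" by blast
    qed auto
  qed
  then obtain C :: "nat \<Rightarrow> 'a set" where C: "\<And>n. finite (C n)"
      "\<And>n x. \<exists>q\<in>C n. dist q x < 1 / (real n + 1)"
    unfolding subset_iff by (simp add: Bex_def) metis
  define J where "J = (SIGMA n:UNIV. C n)"
  have "countable J"
    unfolding J_def using C(1) by (simp add: countable_SIGMA countable_finite)
  moreover obtain q where "q \<in> C 0"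
    using C(2) by blast
  then have "J \<noteq> {}"
    by (auto simp: J_def)
  ultimately have J: "countable J" "J \<noteq> {}" by auto
  define r where "r p = 1 / (real (fst p) + 1)" for p :: "nat \<times> 'a"
  define F where "F i = cball (snd (from_nat_into J i)) (2 * r (from_nat_into J i))" for i
  define G where "G i = - ball (snd (from_nat_into J i)) (r (from_nat_into J i))" for i
  have r0: "r p > 0" for p by (simp add: r_def add_pos_pos add_nonneg_pos)
  show thesis
  proof
    show "closed (F i)" "closed (G i)" for i by (auto simp: F_def G_def)
    show "F i \<union> G i = UNIV" for i
      using r0[of "from_nat_into J i"] by (auto simp: F_def G_def)
    fix x y :: 'a assume "x \<noteq> y"
    then obtain n :: nat where n: "3 / dist x y < real n"
      using reals_Archimedean2 by blast
    \<comment> \<open>\<open>x\<close> lies in the inner ball about \<open>q\<close>, and \<open>y\<close> is too far away for the ball of twice the radius\<close>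
    obtain q where q: "q \<in> C n" "dist q x < 1 / (real n + 1)"
      using C(2) by blast
    then have "(n, q) \<in> J" by (simp add: J_def)
    then obtain i where i: "from_nat_into J i = (n, q)"
      using from_nat_into_surj[OF J(1)] by blast
    have "3 < dist x y * real n"
      using n \<open>x \<noteq> y\<close> by (simp add: field_simps)
    also have "\<dots> \<le> dist x y * (real n + 1)"
      by (intro mult_left_mono) auto
    finally have "3 / (real n + 1) < dist x y"
      by (simp add: field_simps)
    then have "\<not> dist q y \<le> 2 * (1 / (real n + 1))"
      using q dist_triangle[of x y q] by (simp add: dist_commute)
    then show "\<exists>i. x \<notin> G i \<and> y \<notin> F i"
      using q by (intro exI[of _ i]) (auto simp: F_def G_def i r_def)
  qed
qed

text \<open>
  The pairs of an address and its point form a compact set \<open>D\<close>. The coded address is injective on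
  \<open>D\<close>, so \<open>D\<close> is homeomorphic to a compact set of reals, and the other projection of \<open>D\<close> is onto.
  This transfers Helly's selection theorem from the real line to compact metric spaces.
\<close>

lemma compact_metric_image_of_compact_real:
  assumes "compact (UNIV :: 'a::metric_space set)"
  obtains K and s :: "real \<Rightarrow> 'a::metric_space" where "compact K" "continuous_on K s" "s ` K = UNIV"
proof -
  obtain F G :: "nat \<Rightarrow> 'a set" where FG: "\<And>i. closed (F i)" "\<And>i. closed (G i)"
      "\<And>i. F i \<union> G i = UNIV" "\<And>x y. x \<noteq> y \<Longrightarrow> \<exists>i. x \<notin> G i \<and> y \<notin> F i"
    using compact_metric_separating_covers[OF assms] by blast
  define D where "D = {p :: (nat \<Rightarrow> bool) \<times> 'a. \<forall>i. if fst p i then snd p \<in> F i else snd p \<in> G i}"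
  have cl: "closed {p :: (nat \<Rightarrow> bool) \<times> 'a. if fst p i then snd p \<in> F i else snd p \<in> G i}" for i
  proof -
    have *: "closed ((\<lambda>p :: (nat \<Rightarrow> bool) \<times> 'a. fst p i) -` {b})" for b
    proof (rule closed_vimage)
      show "closed {b}" unfolding closed_def by (rule Topological_Spaces.open_discrete)
      show "continuous_on UNIV (\<lambda>p :: (nat \<Rightarrow> bool) \<times> 'a. fst p i)"
        by (rule continuous_on_compose2[OF continuous_on_product_coordinates continuous_on_fst])
          auto
    qed
    have "{p :: (nat \<Rightarrow> bool) \<times> 'a. if fst p i then snd p \<in> F i else snd p \<in> G i} =
        ((\<lambda>p. fst p i) -` {True} \<inter> snd -` F i) \<union> ((\<lambda>p. fst p i) -` {False} \<inter> snd -` G i)"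
      by auto
    then show ?thesis
      using * FG(1,2) by (simp add: closed_Un closed_Int closed_vimage_snd)
  qed
  have "closed D"
    unfolding D_def by (intro closed_Collect_all cl)
  moreover have "compact (UNIV :: ((nat \<Rightarrow> bool) \<times> 'a) set)"
    using compact_Times[OF compact_UNIV_nat_bool assms] by simp
  ultimately have D: "compact D"
    using compact_Int_closed by fastforce
  define p where "p = (\<lambda>z :: (nat \<Rightarrow> bool) \<times> 'a. ternary (fst z))"
  have "continuous_on D p"
    unfolding p_def
    by (intro continuous_on_compose2[OF continuous_on_ternary] continuous_intros) auto
  moreover have "inj_on p D"
  proof (rule inj_onI)
    fix u v assume *: "u \<in> D" "v \<in> D" "p u = p v"
    then have f: "fst u = fst v"
      using inj_ternary by (simp add: p_def inj_eq)
    have "snd u = snd v"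
    proof (rule ccontr)
      assume "snd u \<noteq> snd v"
      then obtain i where "snd u \<notin> G i" "snd v \<notin> F i" using FG(4) by blast
      with * f show False unfolding D_def by (auto split: if_splits)
    qed
    with f show "u = v" by (simp add: prod_eq_iff)
  qed
  ultimately obtain q where q: "homeomorphism D (p ` D) p q"
    using homeomorphism_compact[OF D] by blast
  show thesis
  proof
    show "compact (p ` D)"
      by (rule compact_continuous_image[OF \<open>continuous_on D p\<close> D])
    show "continuous_on (p ` D) (snd \<circ> q)"
      using q by (auto simp: homeomorphism_def comp_def intro!: continuous_intros)
    have "x \<in> snd ` D" for x
    proof -
      have "(\<lambda>i. x \<in> F i, x) \<in> D"
        using FG(3) by (auto simp: D_def)
      then show ?thesis by force
    qed
    then have "snd ` D = UNIV" by auto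
    moreover have "q ` (p ` D) = D"
      using q by (simp add: homeomorphism_def)
    ultimately show "(snd \<circ> q) ` (p ` D) = UNIV"
      unfolding image_comp[symmetric] by simp
  qed
qed

section \<open>The weak-star topology and limits of empirical measures\<close>

lemma continuous_real_bounded:
  fixes \<phi> :: "'a::metric_space \<Rightarrow> real"
  assumes "compact (UNIV :: 'a set)" "continuous_on UNIV \<phi>"
  obtains B where "0 \<le> B" "\<And>x. \<bar>\<phi> x\<bar> \<le> B"
proof -
  have "bounded (range \<phi>)"
    using assms compact_continuous_image compact_imp_bounded by blast
  then obtain B where B: "\<And>x. \<bar>\<phi> x\<bar> \<le> B"
    unfolding bounded_iff by auto
  then have "0 \<le> B" using abs_ge_zero order_trans by blast
  with B show thesis using that by blast
qed

lemma topspace_weak_star: "topspace weak_star = prob_measures"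
proof -
  have "prob_measures \<in> {{\<mu> \<in> prob_measures. integral\<^sup>L \<mu> f \<in> V} |(f :: 'a \<Rightarrow> real) V.
      continuous_on UNIV f \<and> open V}"
    by (rule CollectI, rule exI[of _ "\<lambda>_. 0"], rule exI[of _ UNIV]) auto
  then show ?thesis
    unfolding weak_star_def topology_generated_by_topspace by auto
qed

lemma openin_weak_star_integral:
  assumes "continuous_on UNIV \<phi>" "open V"
  shows "openin weak_star {\<mu> \<in> prob_measures. integral\<^sup>L \<mu> \<phi> \<in> (V :: real set)}"
  unfolding weak_star_def by (rule topology_generated_by_Basis) (use assms in blast)

lemma limitin_weak_star_integral:
  fixes \<phi> :: "'a::topological_space \<Rightarrow> real"
  assumes "limitin weak_star X \<nu> F" "continuous_on UNIV \<phi>"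
  shows "((\<lambda>k. integral\<^sup>L (X k) \<phi>) \<longlongrightarrow> integral\<^sup>L \<nu> \<phi>) F"
proof (rule topological_tendstoI)
  fix V :: "real set" assume V: "open V" "integral\<^sup>L \<nu> \<phi> \<in> V"
  have "\<nu> \<in> prob_measures"
    using assms(1) by (simp add: limitin_def topspace_weak_star)
  then have "\<nu> \<in> {\<mu> \<in> prob_measures. integral\<^sup>L \<mu> \<phi> \<in> V}"
    using V(2) by simp
  then have "\<forall>\<^sub>F k in F. X k \<in> {\<mu> \<in> prob_measures. integral\<^sup>L \<mu> \<phi> \<in> V}"
    using assms(1) openin_weak_star_integral[OF assms(2) V(1)] unfolding limitin_def by blast
  then show "\<forall>\<^sub>F k in F. integral\<^sup>L (X k) \<phi> \<in> V"
    by eventually_elim simp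
qed

lemma limitin_weak_starI:
  assumes \<nu>: "\<nu> \<in> prob_measures" and X: "\<forall>\<^sub>F k in F. X k \<in> prob_measures"
    and conv: "\<And>\<phi> :: 'a::topological_space \<Rightarrow> real. continuous_on UNIV \<phi> \<Longrightarrow> ((\<lambda>k. integral\<^sup>L (X k) \<phi>) \<longlongrightarrow> integral\<^sup>L \<nu> \<phi>) F"
  shows "limitin weak_star X \<nu> F"
  unfolding limitin_def topspace_weak_star
proof (intro conjI allI impI \<nu>, elim conjE)
  fix U assume "openin weak_star U" "\<nu> \<in> U"
  from openin_topology_generated_by[OF this(1)[unfolded weak_star_def]] this(2)
  show "\<forall>\<^sub>F k in F. X k \<in> U"
  proof induction
    case (Int a b)
    then show ?case by (auto intro: eventually_conj)
  next
    case (UN K)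
    then obtain k where "k \<in> K" "\<nu> \<in> k" by auto
    with UN have "\<forall>\<^sub>F i in F. X i \<in> k" by auto
    then show ?case by (rule eventually_mono) (use \<open>k \<in> K\<close> in auto)
  next
    case (Basis s)
    from Basis.hyps obtain \<phi> and V :: "real set" where s: "s = {\<mu> \<in> prob_measures. integral\<^sup>L \<mu> \<phi> \<in> V}"
        and \<phi>: "continuous_on UNIV \<phi>" and V: "open V" by blast
    have "\<forall>\<^sub>F k in F. integral\<^sup>L (X k) \<phi> \<in> V"
      using topological_tendstoD[OF conv[OF \<phi>] V] Basis.prems s by simp
    with X show ?case by eventually_elim (simp add: s)
  qed simp
qed

lemma prob_space_uniform_count_measure_lessThan:
  "0 < n \<Longrightarrow> prob_space (uniform_count_measure {..<n::nat})"
  by (rule prob_space_uniform_count_measure) auto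

lemma measurable_uniform_count: "z \<in> measurable (uniform_count_measure A) borel"
  by (simp add: measurable_def sets_uniform_count_measure space_uniform_count_measure)

lemma integral_distr_uniform_count:
  fixes \<phi> :: "'b::topological_space \<Rightarrow> real"
  assumes "0 < n" "\<phi> \<in> borel_measurable borel"
  shows "integral\<^sup>L (distr (uniform_count_measure {..<n}) borel z) \<phi> = (\<Sum>j<n. \<phi> (z j)) / real n"
proof -
  have "integral\<^sup>L (distr (uniform_count_measure {..<n}) borel z) \<phi> =
      integral\<^sup>L (uniform_count_measure {..<n}) (\<lambda>j. \<phi> (z j))"
    by (rule integral_distr[OF measurable_uniform_count assms(2)])
  also have "\<dots> = (\<Sum>j<n. \<phi> (z j)) / real n"
    unfolding uniform_count_measure_def
    by (subst lebesgue_integral_point_measure_finite) (auto simp: sum_divide_distrib)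
  finally show ?thesis .
qed

lemma prob_space_distr_uniform_count:
  "0 < n \<Longrightarrow> prob_space (distr (uniform_count_measure {..<n}) borel (z :: nat \<Rightarrow> 'b::topological_space))"
  by (rule prob_space.prob_space_distr[OF prob_space_uniform_count_measure_lessThan
        measurable_uniform_count])

lemma empirical_measure_prob: "0 < n \<Longrightarrow> empirical_measure f x n \<in> prob_measures"
  by (simp add: prob_measures_def empirical_measure_def prob_space_distr_uniform_count)

text \<open>
  Lift the orbit to the compact set \<open>K\<close> of reals that is mapped onto the space by \<open>s\<close>. The uniform
  measures on initial segments of the lifted orbit are tight, so Helly's theorem gives a weak limit
  along a subsequence, and its image under \<open>s\<close> is the measure sought. Bounded continuous functions on
  \<open>K\<close> have to be extended to the real line by Tietze's theorem before weak convergence applies.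
\<close>

lemma p_omega_nonempty:
  fixes f :: "'a::metric_space \<Rightarrow> 'a"
  assumes "compact (UNIV :: 'a set)"
  shows "p_omega f x \<noteq> {}"
proof -
  obtain K and s :: "real \<Rightarrow> 'a" where K: "compact K" and s: "continuous_on K s" "s ` K = UNIV"
    using compact_metric_image_of_compact_real[OF assms] .
  then have Kcl: "closed K" and Kne: "K \<noteq> {}" by (auto simp: compact_imp_closed)
  have "\<forall>j. \<exists>t. t \<in> K \<and> s t = (f ^^ j) x"
    using s(2) by (metis UNIV_I imageE)
  then obtain z where z: "\<And>j. z j \<in> K" "\<And>j. s (z j) = (f ^^ j) x" by metis
  define \<mu> where "\<mu> n = distr (uniform_count_measure {..<Suc n}) borel z" for n
  \<comment> \<open>\<open>Suc n\<close> because there is no average over an empty orbit segment\<close>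
  have \<mu>: "real_distribution (\<mu> n)" for n
    unfolding real_distribution_def real_distribution_axioms_def \<mu>_def
    by (simp add: prob_space_distr_uniform_count)
  obtain b where b: "\<And>t. t \<in> K \<Longrightarrow> \<bar>t\<bar> \<le> b"
    using compact_imp_bounded[OF K] unfolding bounded_iff by auto
  have b0: "0 \<le> b" using b z(1)[of 0] by force
  have "tight \<mu>"
    unfolding tight_def
  proof (intro conjI allI impI \<mu> exI)
    fix e :: real and n assume e: "e > 0"
    show "- b - 1 < b" using b0 by simp
    have "emeasure (\<mu> n) {- b - 1<..b} = 1"
    proof -
      have "z -` {- b - 1<..b} \<inter> {..<Suc n} = {..<Suc n}"
        using b z(1) by (force simp: abs_le_iff)
      then show ?thesis
        using prob_space.emeasure_space_1[OF prob_space_uniform_count_measure_lessThan[of "Suc n"]]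
        unfolding \<mu>_def
        by (subst emeasure_distr[OF measurable_uniform_count])
          (auto simp: space_uniform_count_measure)
    qed
    then show "1 - e < measure (\<mu> n) {- b - 1<..b}"
      using e by (simp add: measure_def)
  qed
  from tight_imp_convergent_subsubsequence[OF this, of id]
  obtain r M where r: "strict_mono r" and M: "real_distribution M" and conv: "weak_conv_m (\<mu> \<circ> r) M"
    by (auto simp: strict_mono_def)
  interpret M: real_distribution M by (rule M)
  have lim: "(\<lambda>n. integral\<^sup>L (\<mu> (r n)) \<phi>) \<longlonglongrightarrow> integral\<^sup>L M \<phi>"
    if "continuous_on UNIV \<phi>" "\<And>t. norm (\<phi> t) \<le> B" for \<phi> :: "real \<Rightarrow> real" and B
    using weak_conv_imp_integral_bdd_continuous_conv[of "\<mu> \<circ> r" M \<phi> B] \<mu> M conv that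
    by (auto simp: continuous_on_eq_continuous_at comp_def)
  have int\<mu>: "integral\<^sup>L (\<mu> n) \<phi> = (\<Sum>j<Suc n. \<phi> (z j)) / real (Suc n)"
    if "continuous_on UNIV \<phi>" for \<phi> :: "real \<Rightarrow> real" and n
    unfolding \<mu>_def
    by (rule integral_distr_uniform_count) (auto intro: borel_measurable_continuous_onI that)
  \<comment> \<open>the truncated distance to \<open>K\<close> has integral 0 for all approximating measures, hence for their limit\<close>
  have AEK: "AE t in M. t \<in> K"
  proof -
    define \<phi> where "\<phi> t = min 1 (infdist t K)" for t :: real
    have \<phi>: "continuous_on UNIV \<phi>" "\<And>t. norm (\<phi> t) \<le> 1"
      by (auto simp: \<phi>_def infdist_nonneg intro!: continuous_intros)
    have "(\<lambda>n. integral\<^sup>L (\<mu> (r n)) \<phi>) \<longlonglongrightarrow> 0"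
      by (subst int\<mu>[OF \<phi>(1)]) (simp add: \<phi>_def z(1))
    then have "integral\<^sup>L M \<phi> = 0"
      using lim[OF \<phi>] LIMSEQ_unique by blast
    moreover have "integrable M \<phi>"
      using \<phi> borel_measurable_continuous_onI[OF \<phi>(1)]
      by (intro M.integrable_const_bound[of _ 1])
        (simp_all add: measurable_cong_sets[OF M.events_eq_borel refl])
    ultimately have "AE t in M. \<phi> t = 0"
      using integral_nonneg_eq_0_iff_AE[of M \<phi>] by (simp add: \<phi>_def infdist_nonneg)
    then show ?thesis
      by eventually_elim
        (auto simp: \<phi>_def min_def in_closed_iff_infdist_zero[OF Kcl Kne] split: if_splits)
  qed
  \<comment> \<open>outside \<open>K\<close>, a null set of the limit, any value will do\<close>
  define S where "S t = (if t \<in> K then s t else x)" for t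
  have S[measurable]: "S \<in> borel_measurable borel"
    unfolding S_def
    by (rule borel_measurable_continuous_on_if) (use Kcl s in auto)
  define \<nu> where "\<nu> = distr M borel S"
  have "limitin weak_star (\<lambda>k. empirical_measure f x (Suc (r k))) \<nu> sequentially"
  proof (rule limitin_weak_starI)
    show "\<nu> \<in> prob_measures"
      unfolding prob_measures_def \<nu>_def by (auto intro!: M.prob_space_distr)
    show "\<forall>\<^sub>F k in sequentially. empirical_measure f x (Suc (r k)) \<in> prob_measures"
      by (simp add: empirical_measure_prob)
    fix \<phi> :: "'a \<Rightarrow> real" assume \<phi>: "continuous_on UNIV \<phi>"
    then have \<phi>m[measurable]: "\<phi> \<in> borel_measurable borel"
      by (rule borel_measurable_continuous_onI)
    obtain B where B: "0 \<le> B" "\<And>y. \<bar>\<phi> y\<bar> \<le> B"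
      using continuous_real_bounded[OF assms \<phi>] by blast
    have "continuous_on K (\<lambda>t. \<phi> (s t))"
      by (rule continuous_on_compose2[OF \<phi> s(1)]) auto
    then obtain \<psi> where \<psi>: "continuous_on UNIV \<psi>" "\<And>t. t \<in> K \<Longrightarrow> \<psi> t = \<phi> (s t)"
        "\<And>t. norm (\<psi> t) \<le> B"
    proof (rule Tietze[of K "\<lambda>t. \<phi> (s t)" UNIV B])
      show "closedin (top_of_set UNIV) K" using Kcl by simp
    qed (use B in auto)
    have "integral\<^sup>L \<nu> \<phi> = integral\<^sup>L M (\<lambda>t. \<phi> (S t))"
      unfolding \<nu>_def by (rule integral_distr) auto
    also have "\<dots> = integral\<^sup>L M \<psi>"
    proof (rule integral_cong_AE)
      have "(\<lambda>t. \<phi> (S t)) \<in> borel_measurable borel" by measurable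
      then show "(\<lambda>t. \<phi> (S t)) \<in> borel_measurable M"
        by (simp add: measurable_cong_sets[OF M.events_eq_borel refl])
      show "\<psi> \<in> borel_measurable M"
        using borel_measurable_continuous_onI[OF \<psi>(1)]
        by (simp add: measurable_cong_sets[OF M.events_eq_borel refl])
      show "AE t in M. \<phi> (S t) = \<psi> t"
        using AEK by eventually_elim (simp add: S_def \<psi>(2))
    qed
    finally have "integral\<^sup>L \<nu> \<phi> = integral\<^sup>L M \<psi>" .
    moreover have "integral\<^sup>L (empirical_measure f x (Suc (r k))) \<phi> = integral\<^sup>L (\<mu> (r k)) \<psi>" for k
      unfolding int\<mu>[OF \<psi>(1)] empirical_measure_def integral_distr_uniform_count[OF zero_less_Suc \<phi>m]
      by (simp only: \<psi>(2)[OF z(1)] z(2))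
    ultimately show "(\<lambda>k. integral\<^sup>L (empirical_measure f x (Suc (r k))) \<phi>) \<longlonglongrightarrow> integral\<^sup>L \<nu> \<phi>"
      using lim[OF \<psi>(1,3)] by simp
  qed
  then have "\<nu> \<in> p_omega f x"
    unfolding p_omega_def using strict_monoD[OF r]
    by (intro CollectI exI[of _ "\<lambda>k. Suc (r k)"]) (simp add: strict_mono_def)
  then show ?thesis by blast
qed

lemma p_omega_prob: "\<nu> \<in> p_omega f x \<Longrightarrow> \<nu> \<in> prob_measures"
  by (auto simp: p_omega_def limitin_def topspace_weak_star)

lemma p_omega_averages:
  fixes f :: "'a::topological_space \<Rightarrow> 'a"
  assumes "\<nu> \<in> p_omega f x"
  obtains r :: "nat \<Rightarrow> nat" where "strict_mono r"
    "\<And>\<phi> :: 'a::topological_space \<Rightarrow> real. continuous_on UNIV \<phi> \<Longrightarrow>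
      (\<lambda>k. (\<Sum>j<r k. \<phi> ((f ^^ j) x)) / real (r k)) \<longlonglongrightarrow> integral\<^sup>L \<nu> \<phi>"
proof -
  obtain r where r: "strict_mono r" "0 < r 0"
      and lim: "limitin weak_star (\<lambda>k. empirical_measure f x (r k)) \<nu> sequentially"
    using assms by (auto simp: p_omega_def)
  have rpos: "0 < r k" for k
    using r(2) strict_mono_less_eq[OF r(1), of 0 k] by simp
  show thesis
  proof (rule that[OF r(1)])
    fix \<phi> :: "'a \<Rightarrow> real" assume \<phi>: "continuous_on UNIV \<phi>"
    have "integral\<^sup>L (empirical_measure f x (r k)) \<phi> = (\<Sum>j<r k. \<phi> ((f ^^ j) x)) / real (r k)" for k
      unfolding empirical_measure_def
      by (rule integral_distr_uniform_count[OF rpos borel_measurable_continuous_onI[OF \<phi>]])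
    then show "(\<lambda>k. (\<Sum>j<r k. \<phi> ((f ^^ j) x)) / real (r k)) \<longlonglongrightarrow> integral\<^sup>L \<nu> \<phi>"
      using limitin_weak_star_integral[OF lim \<phi>] by simp
  qed
qed

text \<open>
  Finitely many terms do not influence limits of averages.
\<close>

lemma p_omega_integral_eq_0:
  fixes \<phi> :: "'a::topological_space \<Rightarrow> real"
  assumes \<nu>: "\<nu> \<in> p_omega f x" and \<phi>: "continuous_on UNIV \<phi>"
    and z: "\<And>j. N \<le> j \<Longrightarrow> \<phi> ((f ^^ j) x) = 0"
  shows "integral\<^sup>L \<nu> \<phi> = 0"
proof -
  obtain r :: "nat \<Rightarrow> nat" where r: "strict_mono r"
      and lim: "(\<lambda>k. (\<Sum>j<r k. \<phi> ((f ^^ j) x)) / real (r k)) \<longlonglongrightarrow> integral\<^sup>L \<nu> \<phi>"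
    using p_omega_averages[OF \<nu>] \<phi> by metis
  define c where "c = (\<Sum>j<N. \<phi> ((f ^^ j) x))"
  have rtop: "filterlim r at_top sequentially" by (rule filterlim_subseq[OF r])
  then have "(\<lambda>k. c / real (r k)) \<longlonglongrightarrow> 0"
    by (intro tendsto_divide_0[OF tendsto_const] filterlim_at_top_imp_at_infinity
        filterlim_compose[OF filterlim_real_sequentially])
  moreover have "\<forall>\<^sub>F k in sequentially. c / real (r k) = (\<Sum>j<r k. \<phi> ((f ^^ j) x)) / real (r k)"
    using rtop[unfolded filterlim_at_top, rule_format, of N]
  proof eventually_elim
    case (elim k)
    have "(\<Sum>j<r k. \<phi> ((f ^^ j) x)) = c"
      unfolding c_def by (rule sum.mono_neutral_right) (use elim z in auto)
    then show ?case by simp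
  qed
  ultimately have "(\<lambda>k. (\<Sum>j<r k. \<phi> ((f ^^ j) x)) / real (r k)) \<longlonglongrightarrow> 0"
    by (rule Lim_transform_eventually)
  then show ?thesis using lim LIMSEQ_unique by blast
qed

text \<open>
  Continuous functions are all that the weak-star topology sees. Truncated distance functions let it
  detect whether a closed set has full measure.
\<close>

lemma integral_min_infdist_eq_0:
  fixes C :: "'a::metric_space set"
  assumes "\<nu> \<in> prob_measures" "closed C" "C \<noteq> {}"
  shows "integral\<^sup>L \<nu> (\<lambda>x. min 1 (infdist x C)) = 0 \<longleftrightarrow> emeasure \<nu> (- C) = 0"
proof -
  interpret prob_space \<nu> using assms(1) by (simp add: prob_measures_def)
  have [measurable_cong]: "sets \<nu> = sets borel" using assms(1) by (simp add: prob_measures_def)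
  have m: "(\<lambda>x. min 1 (infdist x C)) \<in> borel_measurable \<nu>"
    unfolding measurable_cong_sets[OF \<open>sets \<nu> = sets borel\<close> refl]
    by (intro borel_measurable_continuous_onI continuous_intros)
  have "integrable \<nu> (\<lambda>x. min 1 (infdist x C))"
    by (rule integrable_const_bound[of _ 1]) (use m in \<open>auto simp: infdist_nonneg\<close>)
  then have "integral\<^sup>L \<nu> (\<lambda>x. min 1 (infdist x C)) = 0 \<longleftrightarrow> (AE x in \<nu>. min 1 (infdist x C) = 0)"
    by (rule integral_nonneg_eq_0_iff_AE) (simp add: infdist_nonneg)
  also have "\<dots> \<longleftrightarrow> (AE x in \<nu>. x \<in> C)"
    by (intro AE_cong)
      (auto simp: min_def in_closed_iff_infdist_zero[OF assms(2,3)] split: if_splits)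
  also have "\<dots> \<longleftrightarrow> emeasure \<nu> (- C) = 0"
    using assms(2) by (subst AE_iff_measurable[of "- C"])
      (auto simp: sets_eq_imp_space_eq[OF \<open>sets \<nu> = sets borel\<close>])
  finally show ?thesis .
qed

section \<open>Invariant measures and their mixtures\<close>

text \<open>
  The indicator function of a closed set is the decreasing limit of continuous functions, and closed
  sets form a generator of the Borel sets that is stable under intersections.
\<close>

lemma prob_measures_eqI:
  fixes \<mu> \<nu> :: "'a::metric_space measure"
  assumes \<mu>: "\<mu> \<in> prob_measures" and \<nu>: "\<nu> \<in> prob_measures"
    and eq: "\<And>\<phi> :: 'a \<Rightarrow> real. continuous_on UNIV \<phi> \<Longrightarrow> (\<And>x. 0 \<le> \<phi> x \<and> \<phi> x \<le> 1) \<Longrightarrow>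
      integral\<^sup>L \<mu> \<phi> = integral\<^sup>L \<nu> \<phi>"
  shows "\<mu> = \<nu>"
proof -
  define \<phi> where "\<phi> C k x = 1 - min 1 (real k * infdist x C)" for C and k and x :: 'a
  have cont: "continuous_on UNIV (\<phi> C k)" and bnd: "0 \<le> \<phi> C k x \<and> \<phi> C k x \<le> 1" for C k x
    unfolding \<phi>_def by (auto simp: infdist_nonneg intro!: continuous_intros)
  have lim: "(\<lambda>k. integral\<^sup>L \<kappa> (\<phi> C k)) \<longlonglongrightarrow> measure \<kappa> C"
    if \<kappa>: "\<kappa> \<in> prob_measures" and C: "closed C" "C \<noteq> {}" for \<kappa> and C :: "'a set"
  proof -
    interpret prob_space \<kappa> using \<kappa> by (simp add: prob_measures_def)
    have s: "sets \<kappa> = sets borel" using \<kappa> by (simp add: prob_measures_def)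
    have pw: "(\<lambda>k. \<phi> C k x) \<longlonglongrightarrow> indicator C x" for x
    proof (cases "x \<in> C")
      case False
      then have p: "infdist x C > 0"
        using infdist_nonneg[of x C] in_closed_iff_infdist_zero[OF C] by (auto simp: less_le)
      obtain N :: nat where N: "1 / infdist x C < real N" using reals_Archimedean2 by blast
      have "\<phi> C k x = indicator C x" if "N \<le> k" for k
      proof -
        have "1 < real N * infdist x C" using N p by (simp add: field_simps)
        also have "\<dots> \<le> real k * infdist x C" using that p by (intro mult_right_mono) auto
        finally show ?thesis using False by (simp add: \<phi>_def)
      qed
      then show ?thesis
        by (intro tendsto_eventually eventually_sequentiallyI)
    qed (simp add: \<phi>_def)
    have "(\<lambda>k. integral\<^sup>L \<kappa> (\<phi> C k)) \<longlonglongrightarrow> integral\<^sup>L \<kappa> (indicator C)"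
    proof (rule integral_dominated_convergence[where w = "\<lambda>_. 1"])
      show "\<phi> C k \<in> borel_measurable \<kappa>" for k
        using borel_measurable_continuous_onI[OF cont] by (simp add: measurable_cong_sets[OF s refl])
      show "indicator C \<in> borel_measurable \<kappa>"
        using C by (intro borel_measurable_indicator) (simp add: s)
      show "AE x in \<kappa>. (\<lambda>k. \<phi> C k x) \<longlonglongrightarrow> indicator C x"
        using pw by simp
      show "AE x in \<kappa>. norm (\<phi> C k x) \<le> 1" for k
        using bnd by simp
    qed simp
    moreover have "integral\<^sup>L \<kappa> (indicator C) = measure \<kappa> C"
      using C by (simp add: s sets_eq_imp_space_eq[OF s])
    ultimately show ?thesis by simp
  qed
  interpret M: prob_space \<mu> using \<mu> by (simp add: prob_measures_def)
  interpret N: prob_space \<nu> using \<nu> by (simp add: prob_measures_def)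
  have closed_eq: "emeasure \<mu> C = emeasure \<nu> C" if C: "closed C" for C
  proof (cases "C = {}")
    case False
    have "(\<lambda>k. integral\<^sup>L \<mu> (\<phi> C k)) = (\<lambda>k. integral\<^sup>L \<nu> (\<phi> C k))"
      using eq[OF cont bnd] by simp
    then have "measure \<mu> C = measure \<nu> C"
      using lim[OF \<mu> C False] lim[OF \<nu> C False] LIMSEQ_unique by metis
    then show ?thesis by (simp add: M.emeasure_eq_measure N.emeasure_eq_measure)
  qed simp
  show ?thesis
  proof (rule measure_eqI_generator_eq[where E = "Collect closed" and \<Omega> = UNIV and A = "\<lambda>_. UNIV"])
    show "Int_stable (Collect closed :: 'a set set)"
      by (auto simp: Int_stable_def)
    show "sets \<mu> = sigma_sets UNIV (Collect closed)" "sets \<nu> = sigma_sets UNIV (Collect closed)"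
      using \<mu> \<nu> unfolding prob_measures_def borel_eq_closed by auto
  qed (use closed_eq in auto)
qed

text \<open>
  For \<open>\<phi>\<close> with values between 0 and 1, the averages of \<open>\<phi>\<close> and of \<open>\<phi> \<circ> f\<close> along an orbit segment of length \<open>n\<close> differ only by a
  boundary term of size at most \<open>1 / n\<close>.
\<close>

lemma p_omega_invariant:
  fixes f :: "'a::metric_space \<Rightarrow> 'a"
  assumes K: "compact (UNIV :: 'a set)" and f: "continuous_on UNIV f" and \<nu>: "\<nu> \<in> p_omega f x"
  shows "\<nu> \<in> invariant_measures f"
proof -
  have P: "\<nu> \<in> prob_measures" by (rule p_omega_prob[OF \<nu>])
  then interpret prob_space \<nu> by (simp add: prob_measures_def)
  have s: "sets \<nu> = sets borel" using P by (simp add: prob_measures_def)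
  have fm: "f \<in> measurable \<nu> borel"
    using borel_measurable_continuous_onI[OF f] by (simp add: measurable_cong_sets[OF s refl])
  obtain r :: "nat \<Rightarrow> nat" where r: "strict_mono r"
    and lim: "\<And>\<phi> :: 'a \<Rightarrow> real. continuous_on UNIV \<phi> \<Longrightarrow>
      (\<lambda>k. (\<Sum>j<r k. \<phi> ((f ^^ j) x)) / real (r k)) \<longlonglongrightarrow> integral\<^sup>L \<nu> \<phi>"
    using p_omega_averages[OF \<nu>] by blast
  have "distr \<nu> borel f = \<nu>"
  proof (rule prob_measures_eqI[OF _ P])
    show "distr \<nu> borel f \<in> prob_measures"
      by (simp add: prob_measures_def prob_space_distr[OF fm])
    fix \<phi> :: "'a \<Rightarrow> real" assume \<phi>: "continuous_on UNIV \<phi>" and b: "\<And>x. 0 \<le> \<phi> x \<and> \<phi> x \<le> 1"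
    have \<phi>f: "continuous_on UNIV (\<lambda>y. \<phi> (f y))"
      by (rule continuous_on_compose2[OF \<phi> f]) simp
    have diff: "(\<Sum>j<n. \<phi> (f ((f ^^ j) x))) / real n - (\<Sum>j<n. \<phi> ((f ^^ j) x)) / real n
        = (\<phi> ((f ^^ n) x) - \<phi> x) / real n" for n
    proof -
      have "(\<Sum>j<n. \<phi> (f ((f ^^ j) x))) - (\<Sum>j<n. \<phi> ((f ^^ j) x)) = \<phi> ((f ^^ n) x) - \<phi> x"
        by (induction n) auto
      then show ?thesis by (simp add: diff_divide_distrib[symmetric])
    qed
    have "(\<lambda>k. (\<phi> ((f ^^ r k) x) - \<phi> x) / real (r k)) \<longlonglongrightarrow> 0"
    proof (rule Lim_null_comparison)
      have "\<bar>\<phi> ((f ^^ r k) x) - \<phi> x\<bar> \<le> 1" for k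
        using b[of "(f ^^ r k) x"] b[of x] by linarith
      then show "\<forall>\<^sub>F k in sequentially. norm ((\<phi> ((f ^^ r k) x) - \<phi> x) / real (r k)) \<le> 1 / real (r k)"
        by (simp add: divide_right_mono)
      show "(\<lambda>k. 1 / real (r k)) \<longlonglongrightarrow> 0"
        by (intro tendsto_divide_0[OF tendsto_const] filterlim_at_top_imp_at_infinity
            filterlim_compose[OF filterlim_real_sequentially] filterlim_subseq[OF r])
    qed
    then have "integral\<^sup>L \<nu> (\<lambda>y. \<phi> (f y)) - integral\<^sup>L \<nu> \<phi> = 0"
      using tendsto_diff[OF lim[OF \<phi>f] lim[OF \<phi>]] unfolding diff using LIMSEQ_unique by blast
    moreover have "integral\<^sup>L (distr \<nu> borel f) \<phi> = integral\<^sup>L \<nu> (\<lambda>y. \<phi> (f y))"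
      by (rule integral_distr[OF fm borel_measurable_continuous_onI[OF \<phi>]])
    ultimately show "integral\<^sup>L (distr \<nu> borel f) \<phi> = integral\<^sup>L \<nu> \<phi>" by simp
  qed
  then have "emeasure \<nu> (f -` B) = emeasure \<nu> B" if "B \<in> sets borel" for B
    using emeasure_distr[OF fm that] by (simp add: sets_eq_imp_space_eq[OF s])
  with P show ?thesis by (simp add: invariant_measures_def)
qed

text \<open>
  The convex combination \<open>(1 - t) \<mu> + t \<nu>\<close>, realised as the law of a sample from \<open>\<nu>\<close> or from
  \<open>\<mu>\<close> according to a biased coin, so that integrals come from the Giry monad.
\<close>

definition mixture :: "real \<Rightarrow> 'a measure \<Rightarrow> 'a measure \<Rightarrow> 'a measure" where
  "mixture t \<mu> \<nu> = measure_pmf (bernoulli_pmf t) \<bind> (\<lambda>b. if b then \<nu> else \<mu>)"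

lemma
  fixes \<mu> \<nu> :: "'a::topological_space measure"
  assumes \<mu>: "\<mu> \<in> prob_measures" and \<nu>: "\<nu> \<in> prob_measures" and t: "0 \<le> t" "t \<le> 1"
  shows mixture_prob: "mixture t \<mu> \<nu> \<in> prob_measures"
    and emeasure_mixture: "B \<in> sets borel \<Longrightarrow>
      emeasure (mixture t \<mu> \<nu>) B = ennreal t * emeasure \<nu> B + ennreal (1 - t) * emeasure \<mu> B"
    and integral_mixture: "\<phi> \<in> borel_measurable borel \<Longrightarrow> (\<And>x. \<bar>\<phi> x\<bar> \<le> c) \<Longrightarrow>
      integral\<^sup>L (mixture t \<mu> \<nu>) \<phi> = t * integral\<^sup>L \<nu> \<phi> + (1 - t) * integral\<^sup>L \<mu> \<phi>"
proof -
  let ?N = "\<lambda>b. if b then \<nu> else \<mu>"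
  have ps: "prob_space (?N b)" "sets (?N b) = sets borel" for b
    using \<mu> \<nu> by (auto simp: prob_measures_def)
  have N: "?N \<in> measurable (measure_pmf (bernoulli_pmf t)) (subprob_algebra borel)"
    using \<mu> \<nu> by (auto simp: space_subprob_algebra prob_measures_def prob_space_imp_subprob_space)
  have sets: "sets (mixture t \<mu> \<nu>) = sets borel"
    unfolding mixture_def by (rule sets_bind) (auto simp: ps(2)[of True, simplified] ps(2)[of False, simplified])
  show em: "emeasure (mixture t \<mu> \<nu>) B = ennreal t * emeasure \<nu> B + ennreal (1 - t) * emeasure \<mu> B"
    if "B \<in> sets borel" for B
    unfolding mixture_def
    by (subst emeasure_bind[OF _ N that]) (use t in \<open>auto simp: mult.commute\<close>)
  show "mixture t \<mu> \<nu> \<in> prob_measures"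
    unfolding prob_measures_def
  proof (intro CollectI conjI sets prob_spaceI)
    have "emeasure \<nu> UNIV = 1" "emeasure \<mu> UNIV = 1"
      using prob_space.emeasure_space_1[OF ps(1)[of True]] prob_space.emeasure_space_1[OF ps(1)[of False]]
        sets_eq_imp_space_eq[OF ps(2)[of True]] sets_eq_imp_space_eq[OF ps(2)[of False]] by auto
    then show "emeasure (mixture t \<mu> \<nu>) (space (mixture t \<mu> \<nu>)) = 1"
      using t by (simp add: sets_eq_imp_space_eq[OF sets] em ennreal_plus[symmetric] del: ennreal_plus)
  qed
  show "integral\<^sup>L (mixture t \<mu> \<nu>) \<phi> = t * integral\<^sup>L \<nu> \<phi> + (1 - t) * integral\<^sup>L \<mu> \<phi>"
    if "\<phi> \<in> borel_measurable borel" "\<And>x. \<bar>\<phi> x\<bar> \<le> c"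
    unfolding mixture_def
    by (subst integral_bind[OF that(1) that(2) N, where B' = 1])
      (use t prob_space.emeasure_space_1[OF ps(1)] in
        \<open>auto intro: measure_pmf.finite_measure_axioms simp: mult.commute\<close>)
qed

lemma mixture_invariant:
  assumes "\<mu> \<in> invariant_measures f" "\<nu> \<in> invariant_measures f" "0 \<le> t" "t \<le> 1"
    and "f \<in> borel_measurable borel"
  shows "mixture t \<mu> \<nu> \<in> invariant_measures f"
proof -
  have "f -` B \<in> sets borel" if "B \<in> sets borel" for B
    using measurable_sets[OF assms(5) that] by simp
  then show ?thesis
    using assms by (auto simp: invariant_measures_def mixture_prob emeasure_mixture)
qed

lemma mixture_tendsto:
  fixes \<mu> \<nu> :: "'a::metric_space measure"
  assumes K: "compact (UNIV :: 'a set)" and \<mu>: "\<mu> \<in> prob_measures" and \<nu>: "\<nu> \<in> prob_measures"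
  shows "limitin weak_star (\<lambda>k. mixture (1 / real (Suc k)) \<mu> \<nu>) \<mu> sequentially"
proof (rule limitin_weak_starI[OF \<mu>])
  have t: "0 \<le> 1 / real (Suc k)" "1 / real (Suc k) \<le> 1" for k by auto
  show "\<forall>\<^sub>F k in sequentially. mixture (1 / real (Suc k)) \<mu> \<nu> \<in> prob_measures"
    using mixture_prob[OF \<mu> \<nu> t] by simp
  fix \<phi> :: "'a \<Rightarrow> real" assume \<phi>: "continuous_on UNIV \<phi>"
  obtain c where c: "\<And>x. \<bar>\<phi> x\<bar> \<le> c"
    using continuous_real_bounded[OF K \<phi>] by blast
  have "(\<lambda>k. 1 / real (Suc k) * integral\<^sup>L \<nu> \<phi> + (1 - 1 / real (Suc k)) * integral\<^sup>L \<mu> \<phi>)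
      \<longlonglongrightarrow> 0 * integral\<^sup>L \<nu> \<phi> + (1 - 0) * integral\<^sup>L \<mu> \<phi>"
    by (intro tendsto_intros LIMSEQ_Suc[OF lim_1_over_n])
  then show "(\<lambda>k. integral\<^sup>L (mixture (1 / real (Suc k)) \<mu> \<nu>) \<phi>) \<longlonglongrightarrow> integral\<^sup>L \<mu> \<phi>"
    unfolding integral_mixture[OF \<mu> \<nu> t borel_measurable_continuous_onI[OF \<phi>] c] by simp
qed

section \<open>A zero-one law for pseudo-physical measures\<close>

text \<open>
  Charging both \<open>W\<close> and the complement of \<open>C\<close> is a weak-star open property of measures, so if
  \<open>\<mu>\<close> had it, then so would some \<open>\<nu> \<in> p_omega f x\<close> close to \<open>\<mu>\<close>. But if the orbit of \<open>x\<close> meets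
  \<open>W\<close>, it ends up in \<open>C\<close> and \<open>\<nu>\<close> gives mass 0 to the complement of \<open>C\<close>; otherwise \<open>\<nu>\<close> gives
  mass 0 to \<open>W\<close>.
\<close>

lemma pseudo_physical_zero_one:
  fixes f :: "'a::metric_space \<Rightarrow> 'a"
  assumes K: "compact (UNIV :: 'a set)"
    and d: "Metric_space prob_measures d" "Metric_space.mtopology prob_measures d = weak_star"
    and \<mu>: "\<mu> \<in> pseudo_physical vol d f"
    and C: "closed C" "C \<noteq> {}" and W: "open W" "W \<noteq> UNIV"
    and dich: "\<And>x k. (f ^^ k) x \<in> W \<Longrightarrow> \<exists>N. \<forall>j\<ge>N. (f ^^ j) x \<in> C"
  shows "emeasure \<mu> (- C) = 0 \<or> emeasure \<mu> W = 0"
proof (rule ccontr)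
  assume neg: "\<not> ?thesis"
  interpret D: Metric_space prob_measures d by (rule d)
  define \<phi> where "\<phi> x = min 1 (infdist x C)" for x
  define \<psi> where "\<psi> x = min 1 (infdist x (- W))" for x
  have cont: "continuous_on UNIV \<phi>" "continuous_on UNIV \<psi>"
    unfolding \<phi>_def \<psi>_def by (intro continuous_intros)+
  have \<mu>P: "\<mu> \<in> prob_measures" using \<mu> by (simp add: pseudo_physical_def)
  define U where "U = {\<nu> \<in> prob_measures. integral\<^sup>L \<nu> \<phi> \<in> - {0}} \<inter> {\<nu> \<in> prob_measures. integral\<^sup>L \<nu> \<psi> \<in> - {0}}"
  have "openin weak_star U"
    unfolding U_def by (intro openin_Int openin_weak_star_integral cont) auto
  moreover have "\<mu> \<in> U"
    using neg \<mu>P integral_min_infdist_eq_0[OF \<mu>P C] integral_min_infdist_eq_0[OF \<mu>P, of "- W"] W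
    unfolding U_def \<phi>_def \<psi>_def by auto
  ultimately obtain e where e: "e > 0" "D.mball \<mu> e \<subseteq> U"
    unfolding d(2)[symmetric] D.openin_mtopology by blast
  then have "emeasure vol (basin d f e \<mu>) > 0"
    using \<mu> by (simp add: pseudo_physical_def)
  then have "basin d f e \<mu> \<noteq> {}" by auto
  then obtain x where x: "(INF \<nu>\<in>p_omega f x. d \<nu> \<mu>) < e"
    unfolding basin_def by auto
  have "bdd_below ((\<lambda>\<nu>. d \<nu> \<mu>) ` p_omega f x)"
    by (rule bdd_belowI2[of _ 0]) simp
  \<comment> \<open>the infimum over the empty set would be an unspecified real number, so \<open>p_omega_nonempty\<close> is essential here\<close>
  then obtain \<nu> where \<nu>: "\<nu> \<in> p_omega f x" "d \<nu> \<mu> < e"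
    using x p_omega_nonempty[OF K, of f x] by (subst (asm) cINF_less_iff) auto
  then have "\<nu> \<in> U"
    using e(2) \<mu>P p_omega_prob[OF \<nu>(1)] D.commute[of \<mu> \<nu>] by (auto simp: subset_iff)
  then have ne: "integral\<^sup>L \<nu> \<phi> \<noteq> 0" "integral\<^sup>L \<nu> \<psi> \<noteq> 0" by (auto simp: U_def)
  show False
  proof (cases "\<exists>k. (f ^^ k) x \<in> W")
    case True
    then obtain N where "\<forall>j\<ge>N. (f ^^ j) x \<in> C" using dich by blast
    then have "integral\<^sup>L \<nu> \<phi> = 0"
      by (intro p_omega_integral_eq_0[OF \<nu>(1) cont(1), of N]) (simp add: \<phi>_def)
    with ne show False by simp
  next
    case False
    then have "integral\<^sup>L \<nu> \<psi> = 0"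
      by (intro p_omega_integral_eq_0[OF \<nu>(1) cont(2), of 0]) (simp add: \<psi>_def)
    with ne show False by simp
  qed
qed

text \<open>
  In every neighbourhood of an invariant measure \<open>\<mu>\<close> there are invariant measures that violate the
  zero-one law: mix a small multiple of \<open>\<nu>1\<close> and \<open>\<nu>2\<close> into \<open>\<mu>\<close>.
\<close>

lemma pseudo_physical_empty_interior:
  fixes f :: "'a::metric_space \<Rightarrow> 'a"
  assumes K: "compact (UNIV :: 'a set)"
    and d: "Metric_space prob_measures d" "Metric_space.mtopology prob_measures d = weak_star"
    and f: "continuous_on UNIV f"
    and C: "closed C" and W: "open W" "W \<subseteq> C"
    and dich: "\<And>x k. (f ^^ k) x \<in> W \<Longrightarrow> \<exists>N. \<forall>j\<ge>N. (f ^^ j) x \<in> C"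
    and \<nu>1: "\<nu>1 \<in> invariant_measures f" "emeasure \<nu>1 W \<noteq> 0"
    and \<nu>2: "\<nu>2 \<in> invariant_measures f" "emeasure \<nu>2 (- C) \<noteq> 0"
  shows "subtopology weak_star (invariant_measures f) interior_of pseudo_physical vol d f = {}"
proof (rule ccontr)
  assume "\<not> ?thesis"
  then obtain \<mu> T where T: "openin (subtopology weak_star (invariant_measures f)) T"
      "T \<subseteq> pseudo_physical vol d f" "\<mu> \<in> T"
    unfolding interior_of_def by blast
  then obtain V where V: "openin weak_star V" "T = V \<inter> invariant_measures f"
    by (auto simp: openin_subtopology)
  have \<mu>: "\<mu> \<in> invariant_measures f" "\<mu> \<in> V" using T(3) V by auto
  have inv_prob: "\<kappa> \<in> prob_measures" if "\<kappa> \<in> invariant_measures f" for \<kappa>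
    using that by (simp add: invariant_measures_def)
  have fm: "f \<in> borel_measurable borel" by (rule borel_measurable_continuous_onI[OF f])
  define \<nu> where "\<nu> = mixture (1/2) \<nu>1 \<nu>2"
  have \<nu>: "\<nu> \<in> invariant_measures f"
    unfolding \<nu>_def by (intro mixture_invariant \<nu>1 \<nu>2 fm) auto
  have "limitin weak_star (\<lambda>k. mixture (1 / real (Suc k)) \<mu> \<nu>) \<mu> sequentially"
    by (intro mixture_tendsto K inv_prob \<mu> \<nu>)
  then have "\<forall>\<^sub>F k in sequentially. mixture (1 / real (Suc k)) \<mu> \<nu> \<in> V"
    using V(1) \<mu>(2) unfolding limitin_def by blast
  then obtain k where "mixture (1 / real (Suc k)) \<mu> \<nu> \<in> V"
    by (auto simp: eventually_sequentially)
  moreover define t where "t = 1 / real (Suc k)"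
  ultimately have k: "mixture t \<mu> \<nu> \<in> V" by simp
  have t0: "0 < t" and t: "0 \<le> t" "t \<le> 1" by (auto simp: t_def)
  have "mixture t \<mu> \<nu> \<in> invariant_measures f"
    by (intro mixture_invariant \<mu> \<nu> fm t)
  then have pp: "mixture t \<mu> \<nu> \<in> pseudo_physical vol d f"
    using T(2) V(2) k by blast
  have "emeasure \<nu> W \<noteq> 0" "emeasure \<nu> (- C) \<noteq> 0"
    unfolding \<nu>_def using \<nu>1 \<nu>2 C W
    by (auto simp: emeasure_mixture[OF inv_prob inv_prob] ennreal_eq_0_iff)
  then have "emeasure (mixture t \<mu> \<nu>) W \<noteq> 0"
      "emeasure (mixture t \<mu> \<nu>) (- C) \<noteq> 0"
    using C W t0 by (auto simp: emeasure_mixture[OF inv_prob[OF \<mu>(1)] inv_prob[OF \<nu>] t] ennreal_eq_0_iff)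
  moreover have "C \<noteq> {}" using \<nu>1(2) W(2) by auto
  moreover have "W \<noteq> UNIV" using \<nu>2(2) W(2) by (metis Compl_UNIV_eq emeasure_empty top.extremum_uniqueI)
  ultimately show False
    using pseudo_physical_zero_one[OF K d pp C _ W(1)] dich by blast
qed

section \<open>Attracting blocks\<close>

text \<open>
  Only \<open>B\<close> itself has to return into its interior part \<open>W\<close>, and only at time \<open>n\<close>. The condition
  involves finitely many iterates of a closed set and therefore persists under small perturbations.
\<close>

definition attracting_block :: "('a::topological_space \<Rightarrow> 'a) \<Rightarrow> nat \<Rightarrow> 'a set \<Rightarrow> 'a set \<Rightarrow> bool" where
  "attracting_block f n B W \<longleftrightarrow>
     0 < n \<and> closed B \<and> open W \<and> W \<noteq> {} \<and> W \<subseteq> B \<and> (f ^^ n) ` B \<subseteq> W"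

definition block_orbit :: "('a \<Rightarrow> 'a) \<Rightarrow> nat \<Rightarrow> 'a set \<Rightarrow> 'a set" where
  "block_orbit f n B = (\<Union>i<n. (f ^^ i) ` B)"

definition two_disjoint_blocks ::
  "('a::topological_space \<Rightarrow> 'a) \<Rightarrow> nat \<Rightarrow> 'a set \<Rightarrow> 'a set \<Rightarrow> 'a set \<Rightarrow> 'a set \<Rightarrow> bool" where
  "two_disjoint_blocks f n B W B' W' \<longleftrightarrow>
     attracting_block f n B W \<and> attracting_block f n B' W' \<and> (\<forall>i<n. (f ^^ i) ` B \<subseteq> - B')"

definition proper_block ::
  "('a::topological_space \<Rightarrow> 'a) \<Rightarrow> nat \<Rightarrow> 'a set \<Rightarrow> 'a set \<Rightarrow> 'a \<Rightarrow> bool" where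
  "proper_block f n B W p \<longleftrightarrow> attracting_block f n B W \<and> (\<forall>i<n. (f ^^ i) ` B \<subseteq> - {p})"

lemma continuous_on_funpow:
  fixes f :: "'a::topological_space \<Rightarrow> 'a"
  assumes "continuous_on UNIV f"
  shows "continuous_on UNIV (f ^^ n)"
proof (induction n)
  case (Suc n)
  then show ?case
    using continuous_on_compose2[OF assms Suc] by (simp add: comp_def)
qed (simp add: id_def)

lemma closed_block_orbit:
  fixes f :: "'a::metric_space \<Rightarrow> 'a"
  assumes K: "compact (UNIV :: 'a set)" and f: "continuous_on UNIV f" and "closed B"
  shows "closed (block_orbit f n B)"
proof -
  have "compact B" using compact_Int_closed[OF K \<open>closed B\<close>] by simp
  then have "closed ((f ^^ i) ` B)" for i
    by (intro compact_imp_closed compact_continuous_image)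
      (rule continuous_on_subset[OF continuous_on_funpow[OF f]], auto)
  then show ?thesis unfolding block_orbit_def by auto
qed

lemma attracting_block_subset_orbit:
  assumes "attracting_block f n B W"
  shows "W \<subseteq> B" "B \<subseteq> block_orbit f n B"
  using assms unfolding attracting_block_def block_orbit_def by force+

text \<open>
  Times \<open>k\<close>, \<open>k + n\<close>, \<open>k + 2 n\<close>, and so on are spent in \<open>B\<close>; the times between are covered
  by the first \<open>n\<close> images of \<open>B\<close>.
\<close>

lemma attracting_block_traps:
  assumes A: "attracting_block f n B W" and x: "(f ^^ k) x \<in> B" and "k \<le> j"
  shows "(f ^^ j) x \<in> block_orbit f n B"
proof -
  have n: "0 < n" and ret: "\<And>y. y \<in> B \<Longrightarrow> (f ^^ n) y \<in> B"
    using A by (auto simp: attracting_block_def)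
  have q: "(f ^^ (q * n)) y \<in> B" if "y \<in> B" for q y
    using that by (induction q) (auto simp: funpow_add intro: ret)
  define m where "m = j - k"
  have "(f ^^ (m mod n)) ((f ^^ (m div n * n)) ((f ^^ k) x)) = (f ^^ (m mod n + (m div n * n + k))) x"
    by (simp only: funpow_add comp_apply)
  also have "m mod n + (m div n * n + k) = j"
    using \<open>k \<le> j\<close> by (simp add: m_def)
  finally have "(f ^^ j) x = (f ^^ (m mod n)) ((f ^^ (m div n * n)) ((f ^^ k) x))" ..
  moreover have "m mod n < n" using n by simp
  ultimately show ?thesis
    unfolding block_orbit_def using q[OF x] by blast
qed

lemma p_omega_closed_support:
  fixes f :: "'a::metric_space \<Rightarrow> 'a"
  assumes \<nu>: "\<nu> \<in> p_omega f x" and C: "closed C" and in_C: "\<And>j. N \<le> j \<Longrightarrow> (f ^^ j) x \<in> C"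
  shows "emeasure \<nu> (- C) = 0"
proof -
  have "integral\<^sup>L \<nu> (\<lambda>x. min 1 (infdist x C)) = 0"
    by (rule p_omega_integral_eq_0[OF \<nu>, of _ N]) (auto simp: in_C intro!: continuous_intros)
  moreover have "C \<noteq> {}" using in_C by blast
  ultimately show ?thesis
    using integral_min_infdist_eq_0[OF p_omega_prob[OF \<nu>] C] by simp
qed

lemma invariant_measure_funpow:
  fixes f :: "'a::topological_space \<Rightarrow> 'a"
  assumes \<nu>: "\<nu> \<in> invariant_measures f" and f: "continuous_on UNIV f" and B: "B \<in> sets borel"
  shows "emeasure \<nu> ((f ^^ n) -` B) = emeasure \<nu> B"
proof (induction n)
  case (Suc n)
  have "(f ^^ n) -` B \<in> sets borel"
    using measurable_sets[OF borel_measurable_continuous_onI[OF continuous_on_funpow[OF f]] B] by simp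
  then have "emeasure \<nu> (f -` ((f ^^ n) -` B)) = emeasure \<nu> ((f ^^ n) -` B)"
    using \<nu> by (simp add: invariant_measures_def)
  moreover have "(f ^^ Suc n) -` B = f -` ((f ^^ n) -` B)"
    by (simp add: funpow_swap1 vimage_def)
  ultimately show ?case using Suc by (simp only:)
qed simp

text \<open>
  A limit measure of an orbit that starts in \<open>B\<close> lives on the images of \<open>B\<close>, each of which is
  mapped into \<open>W\<close> by some iterate. By invariance, \<open>W\<close> cannot be a null set.
\<close>

lemma attracting_block_invariant_measure:
  fixes f :: "'a::metric_space \<Rightarrow> 'a"
  assumes K: "compact (UNIV :: 'a set)" and f: "continuous_on UNIV f"
    and A: "attracting_block f n B W"
  obtains \<nu> where "\<nu> \<in> invariant_measures f" "emeasure \<nu> W \<noteq> 0"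
proof -
  have A': "0 < n" "closed B" "open W" "W \<noteq> {}" "W \<subseteq> B" "(f ^^ n) ` B \<subseteq> W"
    using A by (auto simp: attracting_block_def)
  then obtain x where x: "x \<in> B" by blast
  obtain \<nu> where \<nu>: "\<nu> \<in> p_omega f x" using p_omega_nonempty[OF K] by blast
  have inv: "\<nu> \<in> invariant_measures f" by (rule p_omega_invariant[OF K f \<nu>])
  have P: "prob_space \<nu>" and s: "sets \<nu> = sets borel"
    using p_omega_prob[OF \<nu>] by (auto simp: prob_measures_def)
  interpret prob_space \<nu> by (rule P)
  have sp: "space \<nu> = UNIV" using sets_eq_imp_space_eq[OF s] by simp
  have pre: "(f ^^ i) -` W \<in> sets borel" for i
    using measurable_sets[OF borel_measurable_continuous_onI[OF continuous_on_funpow[OF f]], of W] A'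
    by simp
  have "emeasure \<nu> W \<noteq> 0"
  proof
    assume W0: "emeasure \<nu> W = 0"
    have "block_orbit f n B \<subseteq> (\<Union>i<n. (f ^^ (n - i)) -` W)"
    proof
      fix y assume "y \<in> block_orbit f n B"
      then obtain i b where i: "i < n" "b \<in> B" "y = (f ^^ i) b"
        by (auto simp: block_orbit_def)
      have "(f ^^ (n - i)) y = (f ^^ (n - i + i)) b"
        unfolding i(3) by (simp only: funpow_add comp_apply)
      also have "n - i + i = n" using i by simp
      finally have "(f ^^ (n - i)) y = (f ^^ n) b" .
      then show "y \<in> (\<Union>i<n. (f ^^ (n - i)) -` W)" using i A'(6) by blast
    qed
    moreover have "emeasure \<nu> (\<Union>i<n. (f ^^ (n - i)) -` W) \<le> (\<Sum>i<n. emeasure \<nu> ((f ^^ (n - i)) -` W))"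
      by (rule emeasure_subadditive_finite) (use pre s in auto)
    moreover have "\<dots> = 0"
      using invariant_measure_funpow[OF inv f, of W] A' W0 by simp
    moreover have "(\<Union>i<n. (f ^^ (n - i)) -` W) \<in> sets \<nu>"
      using pre s by auto
    ultimately have "emeasure \<nu> (block_orbit f n B) = 0"
      using emeasure_mono[of "block_orbit f n B" "\<Union>i<n. (f ^^ (n - i)) -` W" \<nu>] by simp
    moreover have "closed (block_orbit f n B)" by (rule closed_block_orbit[OF K f A'(2)])
    moreover have "emeasure \<nu> (- block_orbit f n B) = 0"
      using attracting_block_traps[OF A, of 0 x] x calculation(2)
      by (intro p_omega_closed_support[OF \<nu>, of _ 0]) auto
    ultimately have "emeasure \<nu> (block_orbit f n B \<union> - block_orbit f n B) = 0"
      by (intro emeasure_Un_null_set[THEN trans]) (auto simp: null_sets_def s)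
    then show False using emeasure_space_1 sp by simp
  qed
  with inv show thesis using that by blast
qed

lemma attracting_block_empty_interior:
  fixes f :: "'a::metric_space \<Rightarrow> 'a"
  assumes K: "compact (UNIV :: 'a set)"
    and d: "Metric_space prob_measures d" "Metric_space.mtopology prob_measures d = weak_star"
    and f: "continuous_on UNIV f" and A: "attracting_block f n B W"
    and \<nu>: "\<nu> \<in> invariant_measures f" "emeasure \<nu> (- block_orbit f n B) \<noteq> 0"
  shows "subtopology weak_star (invariant_measures f) interior_of pseudo_physical vol d f = {}"
proof -
  obtain \<nu>1 where \<nu>1: "\<nu>1 \<in> invariant_measures f" "emeasure \<nu>1 W \<noteq> 0"
    using attracting_block_invariant_measure[OF K f A] .
  have cl: "closed B" "open W" using A by (auto simp: attracting_block_def)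
  have sub: "W \<subseteq> block_orbit f n B" using attracting_block_subset_orbit[OF A] by blast
  show ?thesis
  proof (rule pseudo_physical_empty_interior[OF K d f closed_block_orbit[OF K f cl(1)] cl(2) sub _ \<nu>1 \<nu>])
    fix x k assume "(f ^^ k) x \<in> W"
    then have "(f ^^ k) x \<in> B" using attracting_block_subset_orbit(1)[OF A] by blast
    then show "\<exists>N. \<forall>j\<ge>N. (f ^^ j) x \<in> block_orbit f n B"
      using attracting_block_traps[OF A] by blast
  qed
qed

lemma two_disjoint_blocks_empty_interior:
  fixes f :: "'a::metric_space \<Rightarrow> 'a"
  assumes K: "compact (UNIV :: 'a set)"
    and d: "Metric_space prob_measures d" "Metric_space.mtopology prob_measures d = weak_star"
    and f: "continuous_on UNIV f" and t: "two_disjoint_blocks f n B W B' W'"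
  shows "subtopology weak_star (invariant_measures f) interior_of pseudo_physical vol d f = {}"
proof -
  have A: "attracting_block f n B W" and A': "attracting_block f n B' W'"
    and disj: "\<And>i. i < n \<Longrightarrow> (f ^^ i) ` B \<subseteq> - B'"
    using t by (auto simp: two_disjoint_blocks_def)
  obtain \<nu> where \<nu>: "\<nu> \<in> invariant_measures f" "emeasure \<nu> W' \<noteq> 0"
    using attracting_block_invariant_measure[OF K f A'] .
  have "W' \<subseteq> - block_orbit f n B"
    using disj attracting_block_subset_orbit(1)[OF A'] by (force simp: block_orbit_def)
  moreover have "closed (block_orbit f n B)"
    using A by (intro closed_block_orbit[OF K f]) (simp add: attracting_block_def)
  moreover have "sets \<nu> = sets borel" using \<nu> by (simp add: invariant_measures_def prob_measures_def)
  ultimately have "emeasure \<nu> W' \<le> emeasure \<nu> (- block_orbit f n B)"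
    by (intro emeasure_mono) auto
  with \<nu> show ?thesis
    by (intro attracting_block_empty_interior[OF K d f A \<nu>(1)]) auto
qed

lemma invariant_measures_inverse:
  fixes f :: "'a::topological_space \<Rightarrow> 'a"
  assumes h: "homeomorphism UNIV UNIV f g" and \<nu>: "\<nu> \<in> invariant_measures g"
  shows "\<nu> \<in> invariant_measures f"
proof -
  have "emeasure \<nu> (f -` B) = emeasure \<nu> B" if B: "B \<in> sets borel" for B
  proof -
    have "f -` B \<in> sets borel"
      using measurable_sets[OF borel_measurable_continuous_onI B, of f] h by (simp add: homeomorphism_def)
    then have "emeasure \<nu> (g -` (f -` B)) = emeasure \<nu> (f -` B)"
      using \<nu> by (simp add: invariant_measures_def)
    moreover have "g -` (f -` B) = B" using h by (auto simp: homeomorphism_def)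
    ultimately show ?thesis by simp
  qed
  with \<nu> show ?thesis by (simp add: invariant_measures_def)
qed

text \<open>
  The union \<open>V\<close> of the first \<open>n\<close> images of \<open>W\<close> is open and forward invariant, so the backward orbit
  of a point outside \<open>V\<close> stays outside \<open>V\<close>. A limit measure of this backward orbit is invariant
  under the inverse of \<open>f\<close>, hence under \<open>f\<close>, and gives mass 0 to \<open>V\<close>. As \<open>f ^^ n\<close> maps the whole
  block orbit into \<open>V\<close>, that orbit has measure 0 as well.
\<close>

lemma proper_block_empty_interior:
  fixes f :: "'a::metric_space \<Rightarrow> 'a"
  assumes K: "compact (UNIV :: 'a set)"
    and d: "Metric_space prob_measures d" "Metric_space.mtopology prob_measures d = weak_star"
    and h: "homeomorphism UNIV UNIV f g" and t: "proper_block f n B W p"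
  shows "subtopology weak_star (invariant_measures f) interior_of pseudo_physical vol d f = {}"
proof -
  have A: "attracting_block f n B W" and p: "\<And>i. i < n \<Longrightarrow> (f ^^ i) ` B \<subseteq> - {p}"
    using t by (auto simp: proper_block_def)
  then have A': "0 < n" "closed B" "open W" "W \<subseteq> B" "(f ^^ n) ` B \<subseteq> W"
    by (auto simp: attracting_block_def)
  have f: "continuous_on UNIV f" and g: "continuous_on UNIV g"
    and fg: "\<And>x. f (g x) = x" and gf: "\<And>x. g (f x) = x"
    using h by (auto simp: homeomorphism_def)
  have gnfn: "(g ^^ i) ((f ^^ i) x) = x" for i x
    by (induction i arbitrary: x) (simp_all add: funpow_swap1 gf)
  have fngn: "(f ^^ i) ((g ^^ i) x) = x" for i x
    by (induction i arbitrary: x) (simp_all add: funpow_swap1 fg)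
  define V where "V = block_orbit f n W"
  have "open ((f ^^ i) ` W)" for i
  proof -
    have "(f ^^ i) ` W = (g ^^ i) -` W"
      using gnfn[of i] fngn[of i] by (auto simp: image_iff) metis
    then show ?thesis using open_vimage[OF A'(3) continuous_on_funpow[OF g]] by simp
  qed
  then have V: "open V" unfolding V_def block_orbit_def by auto
  have VC: "V \<subseteq> block_orbit f n B" using A'(4) unfolding V_def block_orbit_def by blast
  have fV: "f x \<in> V" if "x \<in> V" for x
  proof -
    obtain i w where i: "i < n" "w \<in> W" "x = (f ^^ i) w" using \<open>x \<in> V\<close> by (auto simp: V_def block_orbit_def)
    show ?thesis
    proof (cases "Suc i < n")
      case True
      then have "(f ^^ Suc i) w \<in> V" using i(2) unfolding V_def block_orbit_def by blast
      then show ?thesis using i by simp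
    next
      case False
      then have "n = Suc i" using i by simp
      then have "f x \<in> W" using A'(4,5) i by auto
      then have "(f ^^ 0) (f x) \<in> V" using A'(1) unfolding V_def block_orbit_def by blast
      then show ?thesis by simp
    qed
  qed
  have "(g ^^ j) p \<in> - V" for j
  proof (induction j)
    case 0
    have "p \<notin> block_orbit f n B" using p by (force simp: block_orbit_def)
    with VC show ?case by auto
  next
    case (Suc j)
    then show ?case using fV[of "g ((g ^^ j) p)"] by (auto simp: fg)
  qed
  moreover obtain \<nu> where \<nu>: "\<nu> \<in> p_omega g p" using p_omega_nonempty[OF K] by blast
  ultimately have "emeasure \<nu> (- (- V)) = 0"
    by (intro p_omega_closed_support[OF \<nu>, of _ 0]) (use V in auto)
  then have V0: "emeasure \<nu> V = 0" by simp
  have inv: "\<nu> \<in> invariant_measures f"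
    by (rule invariant_measures_inverse[OF h p_omega_invariant[OF K g \<nu>]])
  have P: "prob_space \<nu>" and s: "sets \<nu> = sets borel"
    using p_omega_prob[OF \<nu>] by (auto simp: prob_measures_def)
  interpret prob_space \<nu> by (rule P)
  have sp: "space \<nu> = UNIV" using sets_eq_imp_space_eq[OF s] by simp
  have cl: "closed (block_orbit f n B)" by (rule closed_block_orbit[OF K f A'(2)])
  have "block_orbit f n B \<subseteq> (f ^^ n) -` V"
  proof
    fix y assume "y \<in> block_orbit f n B"
    then obtain i b where i: "i < n" "b \<in> B" "y = (f ^^ i) b" by (auto simp: block_orbit_def)
    have "(f ^^ n) y = (f ^^ (n + i)) b"
      unfolding i(3) by (simp only: funpow_add comp_apply)
    also have "\<dots> = (f ^^ i) ((f ^^ n) b)"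
      unfolding add.commute[of n i] by (simp only: funpow_add comp_apply)
    finally have "(f ^^ n) y = (f ^^ i) ((f ^^ n) b)" .
    then show "y \<in> (f ^^ n) -` V"
      using i A'(5) unfolding V_def block_orbit_def by blast
  qed
  moreover have "emeasure \<nu> ((f ^^ n) -` V) = 0"
    using invariant_measure_funpow[OF inv f, of V n] V V0 by simp
  moreover have "(f ^^ n) -` V \<in> sets \<nu>"
    using open_vimage[OF V continuous_on_funpow[OF f]] s by simp
  ultimately have "emeasure \<nu> (block_orbit f n B) = 0"
    using emeasure_mono[of "block_orbit f n B" "(f ^^ n) -` V" \<nu>] by simp
  then have "emeasure \<nu> (- block_orbit f n B) = 1"
    using prob_compl[of "block_orbit f n B"] cl
    by (simp add: s sp Compl_eq_Diff_UNIV emeasure_eq_measure)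
  then show ?thesis
    by (intro attracting_block_empty_interior[OF K d f A inv]) simp
qed

section \<open>Uniform metrics and robustness of attracting blocks\<close>

lemma typicalI:
  assumes M: "Metric_space M \<rho>" and G: "G \<subseteq> M"
    and opn: "\<And>f. f \<in> G \<Longrightarrow> \<exists>r>0. \<forall>h\<in>M. \<rho> f h < r \<longrightarrow> h \<in> G"
    and dense: "\<And>f e. f \<in> M \<Longrightarrow> 0 < e \<Longrightarrow> \<exists>h\<in>G. \<rho> f h < e"
    and P: "\<And>f. f \<in> G \<Longrightarrow> P f"
  shows "typical (Metric_space.mtopology M \<rho>) P"
proof -
  interpret Metric_space M \<rho> by (rule M)
  have "openin mtopology G"
    unfolding openin_mtopology
  proof (intro conjI G allI impI)
    fix f assume "f \<in> G"
    then obtain r where "r > 0" "\<forall>h\<in>M. \<rho> f h < r \<longrightarrow> h \<in> G" using opn by blast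
    then show "\<exists>r>0. mball f r \<subseteq> G" by (intro exI[of _ r]) auto
  qed
  moreover have "mtopology closure_of G = M"
    unfolding metric_closure_of using dense G by (auto simp: subset_iff)
  ultimately show ?thesis
    unfolding typical_def by (intro exI[of _ "{G}"]) (use P in auto)
qed

lemma sup_dist_ge:
  fixes f g :: "'a::metric_space \<Rightarrow> 'a"
  assumes "compact (UNIV :: 'a set)"
  shows "dist (f x) (g x) \<le> sup_dist f g"
proof -
  obtain c where "\<And>x y :: 'a. dist x y \<le> c"
    using compact_imp_bounded[OF assms] bounded_two_points by (metis UNIV_I)
  then show ?thesis
    unfolding sup_dist_def by (intro cSUP_upper) (auto intro!: bdd_aboveI2)
qed

lemma sup_dist_le: "(\<And>x. dist (f x) (g x) \<le> e) \<Longrightarrow> sup_dist f g \<le> e"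
  unfolding sup_dist_def by (rule cSUP_least) auto

lemma sup_dist_less:
  assumes "0 < e" "\<And>x. dist (f x) (g x) < e / 2" shows "sup_dist f g < e"
  using sup_dist_le[of f g "e / 2"] assms by (smt (verit) field_sum_of_halves)

lemma sup_dist_metric:
  assumes K: "compact (UNIV :: 'a::metric_space set)"
  shows "Metric_space M (sup_dist :: ('a \<Rightarrow> 'a) \<Rightarrow> ('a \<Rightarrow> 'a) \<Rightarrow> real)"
proof
  fix f g h :: "'a \<Rightarrow> 'a"
  show "0 \<le> sup_dist f g"
    using sup_dist_ge[OF K, of f undefined g] zero_le_dist order_trans by blast
  show "sup_dist f g = sup_dist g f" by (simp add: sup_dist_def dist_commute)
  show "sup_dist f g = 0 \<longleftrightarrow> f = g"
  proof
    assume "sup_dist f g = 0"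
    then have "dist (f x) (g x) \<le> 0" for x using sup_dist_ge[OF K, of f x g] by simp
    then show "f = g" by auto
  qed (simp add: sup_dist_def)
  show "sup_dist f h \<le> sup_dist f g + sup_dist g h"
  proof (rule sup_dist_le)
    fix x show "dist (f x) (h x) \<le> sup_dist f g + sup_dist g h"
      using dist_triangle[of "f x" "h x" "g x"] sup_dist_ge[OF K, of f x g] sup_dist_ge[OF K, of g x h]
      by linarith
  qed
qed

lemma homeo_dist_metric:
  assumes K: "compact (UNIV :: 'a::metric_space set)"
  shows "Metric_space M (homeo_dist :: ('a \<Rightarrow> 'a) \<Rightarrow> ('a \<Rightarrow> 'a) \<Rightarrow> real)"
proof -
  interpret S: Metric_space "UNIV :: ('a \<Rightarrow> 'a) set" sup_dist by (rule sup_dist_metric[OF K])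
  show ?thesis
  proof
    fix f g h :: "'a \<Rightarrow> 'a"
    show "0 \<le> homeo_dist f g" by (simp add: homeo_dist_def le_max_iff_disj)
    show "homeo_dist f g = homeo_dist g f" by (simp add: homeo_dist_def S.commute)
    show "homeo_dist f g = 0 \<longleftrightarrow> f = g"
    proof
      assume "homeo_dist f g = 0"
      then have "sup_dist f g = 0"
        using S.nonneg[of f g] by (simp only: homeo_dist_def max_def split: if_splits)
      then show "f = g" by simp
    qed (simp add: homeo_dist_def)
    show "homeo_dist f h \<le> homeo_dist f g + homeo_dist g h"
      using S.triangle[of f g h, simplified] S.triangle[of "inv f" "inv g" "inv h", simplified]
      unfolding homeo_dist_def by linarith
  qed
qed

lemma compact_uniform_modulus:
  fixes f :: "'a::metric_space \<Rightarrow> 'b::metric_space"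
  assumes K: "compact (UNIV :: 'a set)" and f: "continuous_on UNIV f" and e: "0 < e"
  obtains c where "0 < c" "\<And>x y. dist x y < c \<Longrightarrow> dist (f x) (f y) < e"
proof -
  have "\<exists>c>0. \<forall>x\<in>UNIV. \<forall>x'\<in>UNIV. dist x' x < c \<longrightarrow> dist (f x') (f x) < e"
    using compact_uniformly_continuous[OF f K] e unfolding uniformly_continuous_on_def by blast
  then show thesis using that by auto
qed

lemma funpow_uniformly_close:
  fixes f :: "'a::metric_space \<Rightarrow> 'a"
  assumes K: "compact (UNIV :: 'a set)" and f: "continuous_on UNIV f" and "0 < e"
  shows "\<exists>\<delta>>0. \<forall>h. (\<forall>x. dist (f x) (h x) < \<delta>) \<longrightarrow> (\<forall>x. dist ((f ^^ n) x) ((h ^^ n) x) < e)"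
  using \<open>0 < e\<close>
proof (induction n arbitrary: e)
  case 0
  then show ?case by (intro exI[of _ 1]) auto
next
  case (Suc n)
  obtain c where c: "0 < c" "\<And>x y. dist x y < c \<Longrightarrow> dist (f x) (f y) < e / 2"
    using compact_uniform_modulus[OF K f half_gt_zero[OF Suc.prems]] by blast
  obtain \<delta> where \<delta>: "0 < \<delta>"
      "\<And>h x. (\<forall>x. dist (f x) (h x) < \<delta>) \<Longrightarrow> dist ((f ^^ n) x) ((h ^^ n) x) < c"
    using Suc.IH[OF c(1)] by blast
  show ?case
  proof (intro exI[of _ "min \<delta> (e / 2)"] conjI allI impI)
    fix h x assume h: "\<forall>x. dist (f x) (h x) < min \<delta> (e / 2)"
    have "dist (f ((f ^^ n) x)) (f ((h ^^ n) x)) < e / 2"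
      using h by (intro c(2) \<delta>(2)) auto
    moreover have "dist (f ((h ^^ n) x)) (h ((h ^^ n) x)) < e / 2" using h by auto
    ultimately show "dist ((f ^^ Suc n) x) ((h ^^ Suc n) x) < e"
      using dist_triangle[of "f ((f ^^ n) x)" "h ((h ^^ n) x)" "f ((h ^^ n) x)"] by simp
  qed (use \<delta> Suc.prems in auto)
qed

text \<open>
  Robustness is phrased with a filter on the size of the perturbation so that finitely many conditions
  can be combined without choosing minima.
\<close>

lemma eventually_funpow_image_subset:
  fixes f :: "'a::metric_space \<Rightarrow> 'a"
  assumes K: "compact (UNIV :: 'a set)" and f: "continuous_on UNIV f"
    and B: "closed B" and W: "open W" and sub: "(f ^^ n) ` B \<subseteq> W"
  shows "\<forall>\<^sub>F \<delta> in at_right 0. \<forall>h. (\<forall>x. dist (f x) (h x) < \<delta>) \<longrightarrow> (h ^^ n) ` B \<subseteq> W"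
proof -
  have "compact B" using compact_Int_closed[OF K B] by simp
  then have "compact ((f ^^ n) ` B)"
    by (intro compact_continuous_image continuous_on_subset[OF continuous_on_funpow[OF f]]) auto
  then obtain e where e: "e > 0" "(\<Union>x\<in>(f ^^ n) ` B. ball x e) \<subseteq> W"
    using compact_subset_open_imp_ball_epsilon_subset[OF _ W sub] by blast
  obtain \<delta> where \<delta>: "0 < \<delta>"
      "\<And>h. (\<forall>x. dist (f x) (h x) < \<delta>) \<Longrightarrow> (\<forall>x. dist ((f ^^ n) x) ((h ^^ n) x) < e)"
    using funpow_uniformly_close[OF K f e(1)] by blast
  have "(h ^^ n) ` B \<subseteq> W" if "\<forall>x. dist (f x) (h x) < r" "r < \<delta>" for h r
  proof -
    have "\<forall>x. dist ((f ^^ n) x) ((h ^^ n) x) < e"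
      using that by (intro \<delta>(2)) (auto intro: less_trans)
    then show ?thesis
      using e(2) by (auto simp: subset_iff)
  qed
  then show ?thesis
    using \<delta>(1) unfolding eventually_at_right_field by blast
qed

lemma attracting_block_robust:
  fixes f :: "'a::metric_space \<Rightarrow> 'a"
  assumes K: "compact (UNIV :: 'a set)" and f: "continuous_on UNIV f" and A: "attracting_block f n B W"
  shows "\<forall>\<^sub>F \<delta> in at_right 0. \<forall>h. (\<forall>x. dist (f x) (h x) < \<delta>) \<longrightarrow> attracting_block h n B W"
proof -
  have "\<forall>\<^sub>F \<delta> in at_right 0. \<forall>h. (\<forall>x. dist (f x) (h x) < \<delta>) \<longrightarrow> (h ^^ n) ` B \<subseteq> W"
    by (rule eventually_funpow_image_subset[OF K f]) (use A in \<open>auto simp: attracting_block_def\<close>)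
  then show ?thesis
    by eventually_elim (use A in \<open>auto simp: attracting_block_def\<close>)
qed

lemma block_orbit_avoids_robust:
  fixes f :: "'a::metric_space \<Rightarrow> 'a"
  assumes K: "compact (UNIV :: 'a set)" and f: "continuous_on UNIV f" and B: "closed B" and C: "closed C"
    and avoid: "\<And>i. i < n \<Longrightarrow> (f ^^ i) ` B \<subseteq> - C"
  shows "\<forall>\<^sub>F \<delta> in at_right 0. \<forall>h. (\<forall>x. dist (f x) (h x) < \<delta>) \<longrightarrow> (\<forall>i<n. (h ^^ i) ` B \<subseteq> - C)"
proof -
  have "\<forall>\<^sub>F \<delta> in at_right 0. \<forall>i\<in>{..<n}. \<forall>h. (\<forall>x. dist (f x) (h x) < \<delta>) \<longrightarrow> (h ^^ i) ` B \<subseteq> - C"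
    using eventually_funpow_image_subset[OF K f B, of "- C"] C avoid
    by (intro eventually_ball_finite) auto
  then show ?thesis by eventually_elim auto
qed

lemma eventually_at_right_0_obtain:
  assumes "\<forall>\<^sub>F \<delta>::real in at_right 0. P \<delta>"
  obtains \<delta> where "0 < \<delta>" "P \<delta>"
proof -
  obtain b where "0 < b" "\<And>\<delta>. 0 < \<delta> \<Longrightarrow> \<delta> < b \<Longrightarrow> P \<delta>"
    using assms unfolding eventually_at_right_field by blast
  then show thesis using that[of "b / 2"] by simp
qed

section \<open>Coordinate cells\<close>

lemma interior_halfspace_box_cart:
  fixes a b :: "real ^ 'n::finite"
  assumes "y \<in> box a b" "0 \<le> y $ k"
  shows "\<exists>a'. interior ({y. 0 \<le> y $ k} \<inter> box a b) = box a' b \<and> box a' b \<noteq> {}"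
proof (intro exI conjI)
  define a' where "a' = (\<chi> i. if i = k then max 0 (a $ k) else a $ i)"
  have a': "a' $ i < t \<longleftrightarrow> (i = k \<longrightarrow> 0 < t) \<and> a $ i < t" for i t
    by (simp add: a'_def)
  have "interior {y :: real ^ 'n. 0 \<le> y $ k} = {y. 0 < y $ k}"
    by (rule interior_halfspace_component_ge)
  then have "interior ({y. 0 \<le> y $ k} \<inter> box a b) = {y. 0 < y $ k} \<inter> box a b"
    by (simp add: interior_open open_box)
  also have "\<dots> = box a' b"
    by (auto simp: set_eq_iff mem_box_cart a')
  finally show "interior ({y. 0 \<le> y $ k} \<inter> box a b) = box a' b" .
  have "a $ i < b $ i \<and> y $ i < b $ i" for i
    using assms(1) less_trans by (auto simp: mem_box_cart)
  then show "box a' b \<noteq> {}"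
    using assms(2) unfolding interval_ne_empty_cart a' by (auto intro: le_less_trans)
qed

text \<open>
  Cells are coordinate boxes rather than balls: a box cut by the half-space is still convex, and its
  interior is again a box and therefore homeomorphic to the whole Euclidean space.
\<close>

lemma atlas_convex_cell:
  fixes \<A> :: "('a::metric_space, 'n::finite) chart set" and w :: 'a
  assumes A: "C1_atlas \<A>" and e: "0 < e"
  obtains W and S :: "(real ^ 'n) set" and \<phi> \<psi> a b where
    "open W" "w \<in> W" "W \<subseteq> ball w e" "convex S" "homeomorphism W S \<phi> \<psi>"
    "interior S = box a b" "box a b \<noteq> {}"
proof -
  have "w \<in> (\<Union>c\<in>\<A>. fst c)" using A by (simp add: C1_atlas_def)
  then obtain U \<phi> where c: "(U, \<phi>) \<in> \<A>" "w \<in> U" by auto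
  then have ch: "is_chart (U, \<phi>)" using A by (auto simp: C1_atlas_def)
  then obtain \<psi> where U: "open U" and \<psi>: "homeomorphism U (\<phi> ` U) \<phi> \<psi>"
    by (auto simp: is_chart_def)
  from ch have "\<exists>H. (H = UNIV \<or> (\<exists>k. H = {y. 0 \<le> y $ k})) \<and> openin (top_of_set H) (\<phi> ` U)"
    by (auto simp: is_chart_def)
  then obtain H :: "(real ^ 'n) set" where H: "H = UNIV \<or> (\<exists>k. H = {y. 0 \<le> y $ k})"
      and opH: "openin (top_of_set H) (\<phi> ` U)" by blast
  have "openin (top_of_set U) (U \<inter> ball w e)" by (simp add: openin_open_Int)
  then have "openin (top_of_set (\<phi> ` U)) (\<phi> ` (U \<inter> ball w e))"
    by (rule homeomorphism_imp_open_map[OF \<psi>])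
  then have "openin (top_of_set H) (\<phi> ` (U \<inter> ball w e))"
    using opH openin_trans by blast
  then obtain T where T: "open T" "\<phi> ` (U \<inter> ball w e) = H \<inter> T"
    by (auto simp: openin_open)
  have "\<phi> w \<in> H \<inter> T" unfolding T(2)[symmetric] using c e by auto
  then have "\<phi> w \<in> T" by simp
  from open_contains_box[OF T(1) this]
  obtain a b where ab: "box a b \<subseteq> T" "\<phi> w \<in> box a b" by metis
  define S where "S = H \<inter> box a b"
  define W where "W = U \<inter> \<phi> -` box a b"
  have UH: "\<phi> ` U \<subseteq> H" using opH openin_imp_subset by blast
  have S: "S \<subseteq> \<phi> ` (U \<inter> ball w e)" unfolding T(2) S_def using ab(1) by blast
  have WS: "\<phi> ` W = S" using UH S unfolding W_def S_def by blast
  have Wball: "W \<subseteq> ball w e"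
  proof
    fix x assume x: "x \<in> W"
    then obtain x' where x': "x' \<in> U" "x' \<in> ball w e" "\<phi> x = \<phi> x'"
      using S WS by blast
    have "x = x'"
      using homeomorphism_apply1[OF \<psi>, of x] homeomorphism_apply1[OF \<psi>, of x'] x x'
      by (simp add: W_def)
    with x' show "x \<in> ball w e" by simp
  qed
  have "convex S \<and> (\<exists>a'. interior S = box a' b \<and> box a' b \<noteq> {})"
  proof (cases "H = UNIV")
    case True
    then have "S = box a b" by (simp add: S_def)
    then show ?thesis
      using ab(2) by (intro conjI exI[of _ a]) (auto simp: convex_box interior_open open_box)
  next
    case False
    then obtain k where k: "H = {y. 0 \<le> y $ k}" using H by blast
    have "0 \<le> \<phi> w $ k" using UH c(2) k by auto
    then have "\<exists>a'. interior S = box a' b \<and> box a' b \<noteq> {}"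
      unfolding S_def k by (rule interior_halfspace_box_cart[OF ab(2)])
    moreover have "convex H"
      using convex_halfspace_ge[of 0 "axis k (1::real)"] by (simp add: k inner_axis inner_commute)
    ultimately show ?thesis by (simp add: S_def convex_box convex_Int)
  qed
  then obtain a' where S': "convex S" "interior S = box a' b" "box a' b \<noteq> {}" by blast
  show thesis
  proof (rule that[OF _ _ Wball S'(1) _ S'(2,3)])
    show "open W"
      unfolding W_def using \<psi> U by (intro continuous_open_preimage) (auto simp: homeomorphism_def open_box)
    show "w \<in> W" using c ab by (simp add: W_def)
    show "homeomorphism W S \<phi> \<psi>"
      by (rule homeomorphism_of_subsets[OF \<psi>]) (auto simp: W_def WS[symmetric])
  qed
qed

text \<open>
  The interior points of the manifold, described by the topology alone. That homeomorphisms preserve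
  them is then immediate, and invariance of domain is needed only to locate them inside charts.
\<close>

definition euclidean_points :: "'n::finite itself \<Rightarrow> 'a::topological_space set" where
  "euclidean_points _ =
     {x. \<exists>N. open N \<and> x \<in> N \<and> (\<exists>T :: (real ^ 'n) set. open T \<and> N homeomorphic T)}"

lemma euclidean_points_homeomorphism:
  fixes f :: "'a::topological_space \<Rightarrow> 'a"
  assumes h: "homeomorphism UNIV UNIV f g" and x: "x \<in> euclidean_points TYPE('n::finite)"
  shows "f x \<in> euclidean_points TYPE('n)"
proof -
  obtain N and T :: "(real ^ 'n) set" where N: "open N" "x \<in> N" "open T" "N homeomorphic T"
    using x unfolding euclidean_points_def by blast
  have hN: "homeomorphism N (f ` N) f g"
    by (rule homeomorphism_of_subsets[OF h]) auto
  then have "N homeomorphic f ` N" unfolding homeomorphic_def by blast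
  then have "f ` N homeomorphic T"
    using N(4) homeomorphic_trans homeomorphic_sym[THEN iffD1] by metis
  moreover have "open (f ` N)"
    using homeomorphism_imp_open_map[OF h, of N] N(1) by simp
  ultimately show ?thesis
    unfolding euclidean_points_def using N by blast
qed

text \<open>
  The chart embeds a Euclidean neighbourhood of \<open>x\<close> into Euclidean space, and by invariance of
  domain the image is open there, so \<open>\<phi> x\<close> is not on the flat side of a half-space.
\<close>

lemma euclidean_points_in_cell:
  fixes S :: "(real ^ 'n::finite) set"
  assumes W: "open W" and h: "homeomorphism W S \<phi> \<psi>"
    and x: "x \<in> W" "x \<in> euclidean_points TYPE('n)"
  shows "\<phi> x \<in> interior S"
proof -
  obtain N and T :: "(real ^ 'n) set" where N: "open N" "x \<in> N" "open T" "N homeomorphic T"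
    using x(2) unfolding euclidean_points_def by blast
  then obtain p q where pq: "homeomorphism N T p q" by (auto simp: homeomorphic_def)
  have "openin (top_of_set N) (N \<inter> W)" using W by (simp add: openin_open_Int)
  then have "openin (top_of_set T) (p ` (N \<inter> W))" by (rule homeomorphism_imp_open_map[OF pq])
  then have op: "open (p ` (N \<inter> W))" using N(3) openin_open_trans by blast
  have qp: "q ` (p ` (N \<inter> W)) = N \<inter> W"
    using pq by (force simp: homeomorphism_def image_image)
  have "continuous_on (p ` (N \<inter> W)) (\<phi> \<circ> q)"
  proof (rule continuous_on_compose)
    show "continuous_on (p ` (N \<inter> W)) q"
      using pq by (auto simp: homeomorphism_def elim!: continuous_on_subset)
    show "continuous_on (q ` p ` (N \<inter> W)) \<phi>"
      unfolding qp using h by (auto simp: homeomorphism_def elim!: continuous_on_subset)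
  qed
  moreover have "inj_on (\<phi> \<circ> q) (p ` (N \<inter> W))"
  proof (rule comp_inj_on)
    show "inj_on q (p ` (N \<inter> W))"
      using pq by (auto simp: inj_on_def homeomorphism_def)
    show "inj_on \<phi> (q ` p ` (N \<inter> W))"
      unfolding qp by (rule inj_on_inverseI[of _ \<psi>]) (use homeomorphism_apply1[OF h] in auto)
  qed
  ultimately have "open ((\<phi> \<circ> q) ` (p ` (N \<inter> W)))"
    by (rule invariance_of_domain[OF _ op])
  also have "(\<phi> \<circ> q) ` (p ` (N \<inter> W)) = \<phi> ` (N \<inter> W)"
    by (simp only: image_comp[symmetric] qp)
  finally have "open (\<phi> ` (N \<inter> W))" .
  moreover have "\<phi> ` (N \<inter> W) \<subseteq> S" using h by (auto simp: homeomorphism_def)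
  moreover have "\<phi> x \<in> \<phi> ` (N \<inter> W)" using x(1) N(2) by simp
  ultimately show ?thesis by (metis interiorI)
qed

text \<open>
  The point \<open>w\<close> may lie on the boundary. Its neighbourhood \<open>W'\<close> is then not Euclidean, but the
  part \<open>W\<close> that contains all interior points of \<open>W'\<close> is, so two interior points that are close to
  \<open>w\<close> always lie in a common Euclidean cell.
\<close>

lemma atlas_euclidean_cell:
  fixes \<A> :: "('a::metric_space, 'n::finite) chart set" and w :: 'a
  assumes A: "C1_atlas \<A>" and e: "0 < e"
  obtains W' W where "open W'" "w \<in> W'" "W' \<subseteq> ball w e" "open W" "W \<subseteq> W'"
    "W homeomorphic (UNIV :: (real ^ 'n) set)" "W' \<inter> euclidean_points TYPE('n) \<subseteq> W"
proof -
  obtain W' and S :: "(real ^ 'n) set" and \<phi> \<psi> a b where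
    W': "open W'" "w \<in> W'" "W' \<subseteq> ball w e" and "convex S" and h: "homeomorphism W' S \<phi> \<psi>"
    and int: "interior S = box a b" "box a b \<noteq> {}"
    by (rule atlas_convex_cell[OF A e])
  define W where "W = \<psi> ` interior S"
  have hW: "homeomorphism W (interior S) \<phi> \<psi>"
    by (rule homeomorphism_of_subsets[OF h])
      (use h interior_subset[of S] in \<open>auto simp: W_def homeomorphism_def image_image subset_iff\<close>)
  have "openin (top_of_set S) (interior S)"
    by (simp add: open_subset interior_subset)
  then have "openin (top_of_set W') W"
    unfolding W_def by (rule homeomorphism_imp_open_map[OF homeomorphism_sym[THEN iffD1, OF h]])
  then have W: "open W" "W \<subseteq> W'"
    using W'(1) openin_open_trans openin_imp_subset by blast+
  show thesis
  proof (rule that[OF W' W])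
    have "interior S homeomorphic (UNIV :: (real ^ 'n) set)"
      unfolding int(1) by (rule homeomorphic_box_UNIV[OF int(2)])
    moreover have "W homeomorphic interior S" using hW unfolding homeomorphic_def by blast
    ultimately show "W homeomorphic (UNIV :: (real ^ 'n) set)"
      using homeomorphic_trans by blast
    show "W' \<inter> euclidean_points TYPE('n) \<subseteq> W"
    proof
      fix x assume x: "x \<in> W' \<inter> euclidean_points TYPE('n)"
      then have "\<phi> x \<in> interior S" using euclidean_points_in_cell[OF W'(1) h] by blast
      moreover have "\<psi> (\<phi> x) = x" using homeomorphism_apply1[OF h] x by blast
      ultimately show "x \<in> W" unfolding W_def by force
    qed
  qed
qed

lemma homeomorphic_UNIV_euclidean_points:
  assumes "open W" "W homeomorphic (UNIV :: (real ^ 'n::finite) set)"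
  shows "W \<subseteq> euclidean_points TYPE('n)"
proof
  fix x assume "x \<in> W"
  with assms show "x \<in> euclidean_points TYPE('n)"
    unfolding euclidean_points_def
    by (intro CollectI exI[of _ W] conjI exI[of _ "UNIV :: (real ^ 'n) set"]) auto
qed

lemma atlas_infinite_ball:
  fixes \<A> :: "('a::metric_space, 'n::finite) chart set" and w :: 'a
  assumes A: "C1_atlas \<A>" and e: "0 < e"
  shows "infinite (ball w e)"
proof -
  obtain W' W where "open W'" "w \<in> W'" and W: "W' \<subseteq> ball w e" and "open W"
      and W': "W \<subseteq> W'" "W homeomorphic (UNIV :: (real ^ 'n) set)"
      and "W' \<inter> euclidean_points TYPE('n) \<subseteq> W"
    by (rule atlas_euclidean_cell[OF A e])
  have "infinite (UNIV :: (real ^ 'n) set)"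
  proof
    assume fin: "finite (UNIV :: (real ^ 'n) set)"
    have "inj (\<lambda>t :: real. axis undefined t :: real ^ 'n)" by (simp add: inj_on_def axis_eq_axis)
    then have "finite (UNIV :: real set)"
      using finite_subset[OF subset_UNIV fin] finite_imageD by blast
    then show False using infinite_UNIV_char_0 by blast
  qed
  then show ?thesis
  proof -
    assume inf: "infinite (UNIV :: (real ^ 'n) set)"
    obtain p q where "homeomorphism W (UNIV :: (real ^ 'n) set) p q"
      using W'(2) unfolding homeomorphic_def by blast
    then have "p ` W = UNIV" by (simp add: homeomorphism_def)
    then have "infinite W" using inf finite_imageI by metis
    then show ?thesis using W W'(1) by (meson finite_subset)
  qed
qed

section \<open>Two disjoint attracting blocks for continuous maps\<close>

lemma distinct_points_nearby:
  fixes c :: "'i \<Rightarrow> 'a::metric_space"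
  assumes inf: "\<And>w :: 'a. infinite (ball w \<theta>)" and I: "finite I"
  shows "\<exists>p. inj_on p I \<and> (\<forall>i\<in>I. dist (p i) (c i) < \<theta>)"
  using I
proof induction
  case (insert i I)
  then obtain p where p: "inj_on p I" "\<forall>i\<in>I. dist (p i) (c i) < \<theta>" by blast
  have "infinite (ball (c i) \<theta> - p ` I)" using inf insert.hyps(1) by simp
  then obtain x where x: "x \<in> ball (c i) \<theta>" "x \<notin> p ` I"
    using infinite_imp_nonempty by blast
  let ?p = "p(i := x)"
  have "\<forall>k\<in>I. ?p k = p k" using insert.hyps(2) by auto
  then have "inj_on ?p (insert i I)"
    using p(1) x(2) insert.hyps(2) by (auto simp: inj_on_def image_iff)
  moreover have "\<forall>k\<in>insert i I. dist (?p k) (c k) < \<theta>"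
    using p(2) x(1) by (auto simp: dist_commute)
  ultimately show ?case by blast
qed simp

lemma recurrent_accumulation_point:
  fixes f :: "'a::metric_space \<Rightarrow> 'a"
  assumes K: "compact (UNIV :: 'a set)"
  shows "\<exists>w. \<forall>V. open V \<longrightarrow> w \<in> V \<longrightarrow> (\<exists>j k. j < k \<and> (f ^^ j) z \<in> V \<and> (f ^^ k) z \<in> V)"
proof -
  have "seq_compact (UNIV :: 'a set)" using K by (rule compact_imp_seq_compact)
  then obtain w r where r: "strict_mono r" and lim: "((\<lambda>k. (f ^^ k) z) \<circ> r) \<longlonglongrightarrow> w"
    unfolding seq_compact_def by blast
  show ?thesis
  proof (intro exI[of _ w] allI impI)
    fix V assume V: "open V" "w \<in> V"
    then have "\<forall>\<^sub>F i in sequentially. (f ^^ r i) z \<in> V"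
      using lim by (auto simp: tendsto_def comp_def)
    then obtain N where N: "\<And>i. N \<le> i \<Longrightarrow> (f ^^ r i) z \<in> V"
      by (auto simp: eventually_sequentially)
    show "\<exists>j k. j < k \<and> (f ^^ j) z \<in> V \<and> (f ^^ k) z \<in> V"
      using N[of N] N[of "Suc N"] strict_monoD[OF r, of N "Suc N"] by auto
  qed
qed

text \<open>
  Inside a cell with convex coordinates, the value of \<open>f\<close> is moved along a segment to \<open>q\<close>. The
  parameter \<open>t\<close> is 1 near \<open>p\<close> and vanishes before the edge of the ball is reached, where the new
  map has to agree with \<open>f\<close>.
\<close>

lemma retarget_point:
  fixes f :: "'a::metric_space \<Rightarrow> 'b::topological_space" and S :: "'c::real_normed_vector set"
  assumes f: "continuous_on UNIV f" and W: "open W" and h: "homeomorphism W S \<phi> \<psi>"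
    and S: "convex S" and p: "f p \<in> W" and q: "q \<in> W" and r: "0 < r"
  obtains g \<delta> where "continuous_on UNIV g" "0 < \<delta>"
    "\<And>x. r \<le> dist p x \<Longrightarrow> g x = f x" "\<And>x. dist p x < \<delta> \<Longrightarrow> g x = q"
    "\<And>x. g x \<noteq> f x \<Longrightarrow> g x \<in> W \<and> f x \<in> W"
proof -
  have "open (f -` W)" using open_vimage[OF W f] .
  moreover have "p \<in> f -` W" using p by simp
  ultimately obtain s0 where s0: "0 < s0" "ball p s0 \<subseteq> f -` W"
    by (meson open_contains_ball)
  define s where "s = min s0 r"
  have s: "0 < s" "s \<le> r" "\<And>x. dist p x < s \<Longrightarrow> f x \<in> W"
    using s0 r by (auto simp: s_def subset_iff)
  define t where "t x = max 0 (min 1 (2 - 3 * dist p x / s))" for x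
  have t01: "0 \<le> t x" "t x \<le> 1" for x by (auto simp: t_def)
  have t1: "t x = 1" if "dist p x < s / 3" for x using that s(1) by (simp add: t_def field_simps)
  have t0: "t x = 0" if "2 * s / 3 < dist p x" for x using that s(1) by (simp add: t_def field_simps)
  have tc: "continuous_on A t" for A unfolding t_def by (intro continuous_intros) (use s(1) in auto)
  define m where "m x = (1 - t x) *\<^sub>R \<phi> (f x) + t x *\<^sub>R \<phi> q" for x
  have \<phi>S: "\<phi> y \<in> S" if "y \<in> W" for y using h that by (auto simp: homeomorphism_def)
  have \<psi>W: "\<psi> y \<in> W" if "y \<in> S" for y using h that by (auto simp: homeomorphism_def)
  have mS: "m x \<in> S" if "dist p x < s" for x
    unfolding m_def using convexD_alt[OF S \<phi>S \<phi>S t01] s(3)[OF that] q by simp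
  define g where "g x = (if dist p x < s then \<psi> (m x) else f x)" for x
  have gf: "g x = f x" if "2 * s / 3 < dist p x" for x
    using t0[OF that] s(3)[of x] homeomorphism_apply1[OF h] by (simp add: g_def m_def)
  show thesis
  proof (rule that[of g "s / 3"])
    have "continuous_on (ball p s) m"
      unfolding m_def
    proof (intro continuous_intros tc)
      show "continuous_on (ball p s) (\<lambda>x. \<phi> (f x))"
        by (rule continuous_on_compose2[of W \<phi>])
          (use h s(3) in \<open>auto simp: homeomorphism_def intro: continuous_on_subset[OF f]\<close>)
    qed
    then have "continuous_on (ball p s) (\<lambda>x. \<psi> (m x))"
      by (rule continuous_on_compose2[of S \<psi>, rotated]) (use h mS in \<open>auto simp: homeomorphism_def\<close>)
    then have c1: "continuous_on (ball p s) g"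
      by (rule continuous_on_eq) (simp add: g_def)
    have c2: "continuous_on (- cball p (2 * s / 3)) g"
      by (rule continuous_on_eq[of _ f]) (use gf in \<open>auto intro: continuous_on_subset[OF f]\<close>)
    have "ball p s \<union> - cball p (2 * s / 3) = UNIV" using s(1) by auto
    then show "continuous_on UNIV g"
      using continuous_on_open_Un[OF open_ball open_Compl[OF closed_cball] c1 c2] by simp
    show "0 < s / 3" using s by simp
    show "g x = f x" if "r \<le> dist p x" for x using that s by (simp add: g_def)
    show "g x = q" if "dist p x < s / 3" for x
      using that s(1) t1[OF that] homeomorphism_apply1[OF h q] by (simp add: g_def m_def)
    show "g x \<in> W \<and> f x \<in> W" if "g x \<noteq> f x" for x
      using that \<psi>W[OF mS[of x]] s(3)[of x] by (auto simp: g_def split: if_splits)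
  qed
qed

definition convex_cell :: "'c::real_normed_vector itself \<Rightarrow> 'a::topological_space set \<Rightarrow> bool" where
  "convex_cell _ W \<longleftrightarrow> open W \<and> (\<exists>(S :: 'c set) \<phi> \<psi>. convex S \<and> homeomorphism W S \<phi> \<psi>)"

text \<open>
  The points of \<open>P\<close> are treated one after the other in disjoint balls. Each point of the space is
  affected at most once, and so the distance from \<open>f\<close> does not accumulate.
\<close>

lemma retarget_finite:
  fixes f :: "'a::metric_space \<Rightarrow> 'b::metric_space"
  assumes f: "continuous_on UNIV f" and e: "0 < e" and r: "0 < r" and P: "finite P"
    and cells: "\<And>p. p \<in> P \<Longrightarrow> \<exists>W. convex_cell TYPE('c::real_normed_vector) W \<and> f p \<in> W \<and> T p \<in> W \<and>
      (\<forall>x\<in>W. \<forall>y\<in>W. dist x y < e)"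
  shows "\<exists>g \<delta>. continuous_on UNIV g \<and> 0 < \<delta> \<and> (\<forall>x. (\<forall>p\<in>P. r \<le> dist p x) \<longrightarrow> g x = f x) \<and>
    (\<forall>p\<in>P. \<forall>x. dist p x < \<delta> \<longrightarrow> g x = T p) \<and> (\<forall>x. dist (g x) (f x) < e)"
  using P cells r
proof (induction arbitrary: r)
  case empty
  then show ?case using f e by (intro exI[of _ f] exI[of _ 1]) simp
next
  case (insert p P)
  obtain d where d: "0 < d" "\<And>x. x \<in> P \<Longrightarrow> x \<noteq> p \<Longrightarrow> d \<le> dist p x"
    using finite_set_avoid[OF insert.hyps(1), of p] by blast
  define r' where "r' = min r (d / 2)"
  have r': "0 < r'" "r' \<le> r" using d insert.prems by (auto simp: r'_def)
  have far: "r' \<le> dist p' x" if "p' \<in> P" "dist p x < r'" for p' x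
  proof -
    have "d \<le> dist p p'" using d(2)[OF that(1)] insert.hyps(2) that(1) by blast
    moreover have "dist p x < d / 2" "r' \<le> d / 2" using that(2) by (auto simp: r'_def)
    ultimately show ?thesis
      using dist_triangle[of p p' x] dist_commute[of x p'] by linarith
  qed
  obtain g1 \<delta>1 where g1: "continuous_on UNIV g1" "0 < \<delta>1"
      "\<And>x. (\<forall>p\<in>P. r' \<le> dist p x) \<Longrightarrow> g1 x = f x"
      "\<And>p x. p \<in> P \<Longrightarrow> dist p x < \<delta>1 \<Longrightarrow> g1 x = T p" "\<And>x. dist (g1 x) (f x) < e"
    using insert.IH[OF insert.prems(1) r'(1)] by blast
  have g1f: "g1 x = f x" if "dist p x < r'" for x
    using g1(3) far that by blast
  obtain W where W: "convex_cell TYPE('c) W" "f p \<in> W" "T p \<in> W" "\<forall>x\<in>W. \<forall>y\<in>W. dist x y < e"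
    using insert.prems(1)[of p] by blast
  then obtain S :: "'c set" and \<phi> \<psi> where S: "open W" "homeomorphism W S \<phi> \<psi>" "convex S"
    by (auto simp: convex_cell_def)
  have "g1 p \<in> W" using g1f[of p] r' W(2) by simp
  from retarget_point[OF g1(1) S this W(3) r'(1)]
  obtain g \<delta>2 where g: "continuous_on UNIV g" "0 < \<delta>2" "\<And>x. r' \<le> dist p x \<Longrightarrow> g x = g1 x"
      "\<And>x. dist p x < \<delta>2 \<Longrightarrow> g x = T p" "\<And>x. g x \<noteq> g1 x \<Longrightarrow> g x \<in> W \<and> g1 x \<in> W"
    by metis
  show ?case
  proof (intro exI[of _ g] exI[of _ "min (min \<delta>1 \<delta>2) r'"] conjI allI impI ballI)
    show "continuous_on UNIV g" by (rule g(1))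
    show "0 < min (min \<delta>1 \<delta>2) r'" using g1 g r' by simp
    show "g x = f x" if "\<forall>p\<in>insert p P. r \<le> dist p x" for x
      using that r' g(3)[of x] g1(3)[of x] by force
    show "g x = T p'" if "p' \<in> insert p P" "dist p' x < min (min \<delta>1 \<delta>2) r'" for p' x
    proof (cases "p' = p")
      case True
      then show ?thesis using g(4) that by simp
    next
      case False
      then have "p' \<in> P" using that by simp
      moreover have "r' \<le> dist p x"
        using far[OF \<open>p' \<in> P\<close>, of x] that(2) by fastforce
      ultimately show ?thesis using g(3) g1(4) that(2) by simp
    qed
    show "dist (g x) (f x) < e" for x
    proof (cases "g x = g1 x")
      case False
      then have "dist p x < r'" using g(3) by force
      then have "g1 x = f x" by (rule g1f)
      then show ?thesis using g(5)[OF False] W(4) by auto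
    qed (use g1 in simp)
  qed
qed

lemma retargeted_cycle_funpow:
  assumes n: "0 < n" and g: "\<And>i x. i < n \<Longrightarrow> dist (c i) x < \<delta> \<Longrightarrow> g x = c (Suc i mod n)"
    and x: "dist (c 0) x < \<delta>" and "0 < \<delta>"
  shows "(g ^^ Suc i) x = c (Suc i mod n)"
proof (induction i)
  case 0
  then show ?case using g[OF n x] by simp
next
  case (Suc i)
  have "g (c (Suc i mod n)) = c (Suc (Suc i mod n) mod n)"
    using n \<open>0 < \<delta>\<close> by (intro g) auto
  then show ?case using Suc by (simp add: mod_Suc_eq)
qed

text \<open>
  Two points of an orbit that are close to each other close up to a periodic pseudo-orbit \<open>z\<close>. As
  balls are infinite, \<open>z\<close> can be shadowed by two pseudo-orbits whose \<open>2 n\<close> points are pairwise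
  distinct; the boolean in the index tells them apart. After retargeting, both are superattracting
  cycles: small balls about their points are collapsed to the next point.
\<close>

lemma dense_two_disjoint_blocks:
  fixes \<A> :: "('a::metric_space, 'n::finite) chart set" and f :: "'a \<Rightarrow> 'a"
  assumes K: "compact (UNIV :: 'a set)" and A: "C1_atlas \<A>"
    and f: "continuous_on UNIV f" and e: "0 < e"
  shows "\<exists>g. continuous_on UNIV g \<and> (\<forall>x. dist (g x) (f x) < e) \<and>
    (\<exists>n B W B' W'. two_disjoint_blocks g n B W B' W')"
proof -
  define \<C> where "\<C> = {W :: 'a set. convex_cell TYPE(real ^ 'n) W \<and> (\<forall>x\<in>W. \<forall>y\<in>W. dist x y < e)}"
  have cov: "\<exists>W\<in>\<C>. w \<in> W" for w
  proof -
    have "0 < e / 2" using e by simp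
    from atlas_convex_cell[OF A this, of w]
    obtain W and S :: "(real ^ 'n) set" and \<phi> \<psi> where W: "open W" "w \<in> W" "W \<subseteq> ball w (e / 2)"
        "convex S" "homeomorphism W S \<phi> \<psi>" by metis
    have "dist x y < e" if "x \<in> W" "y \<in> W" for x y
    proof -
      have "dist w x < e / 2" "dist w y < e / 2" using that W(3) by auto
      then show ?thesis by (rule dist_triangle_half_r)
    qed
    then show ?thesis using W unfolding \<C>_def convex_cell_def by blast
  qed
  obtain \<eta> where \<eta>: "0 < \<eta>" "\<And>T. T \<subseteq> UNIV \<Longrightarrow> diameter T < \<eta> \<Longrightarrow> \<exists>W\<in>\<C>. T \<subseteq> W"
  proof (rule Lebesgue_number_lemma[OF K, of \<C>])
    show "\<C> \<noteq> {}" "UNIV \<subseteq> \<Union>\<C>" using cov by blast+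
    show "open W" if "W \<in> \<C>" for W using that by (simp add: \<C>_def convex_cell_def)
  qed blast
  have two: "\<exists>W\<in>\<C>. x \<in> W \<and> y \<in> W" if "dist x y < \<eta>" for x y
  proof -
    have "diameter {x, y} \<le> dist x y"
      by (auto simp: diameter_def dist_commute intro!: cSup_least)
    then have "diameter {x, y} < \<eta>" using that by simp
    then show ?thesis using \<eta>(2)[of "{x, y}"] by auto
  qed
  obtain \<theta>0 where \<theta>0: "0 < \<theta>0" "\<And>x y. dist x y < \<theta>0 \<Longrightarrow> dist (f x) (f y) < \<eta> / 3"
    using compact_uniform_modulus[OF K f, of "\<eta> / 3"] \<eta>(1) by auto
  define \<theta> where "\<theta> = min \<theta>0 (\<eta> / 3)"
  have \<theta>: "0 < \<theta>" "\<theta> \<le> \<eta> / 3" using \<theta>0 \<eta> by (auto simp: \<theta>_def)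
  fix z0 :: 'a
  obtain w where w: "\<And>V. open V \<Longrightarrow> w \<in> V \<Longrightarrow> \<exists>j k. j < k \<and> (f ^^ j) z0 \<in> V \<and> (f ^^ k) z0 \<in> V"
    using recurrent_accumulation_point[OF K, of f z0] by blast
  obtain j k where jk: "j < k" "(f ^^ j) z0 \<in> ball w (\<eta> / 6)" "(f ^^ k) z0 \<in> ball w (\<eta> / 6)"
    using w[of "ball w (\<eta> / 6)"] \<eta>(1) by auto
  define n where "n = k - j"
  have n: "0 < n" using jk by (simp add: n_def)
  define z where "z i = (f ^^ (j + i)) z0" for i
  have zn: "dist (z n) (z 0) < \<eta> / 3"
  proof (rule dist_triangle_half_r)
    show "dist w (z n) < \<eta> / 3 / 2" "dist w (z 0) < \<eta> / 3 / 2"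
      using jk by (simp_all add: z_def n_def)
  qed
  have zS: "f (z i) = z (Suc i)" for i by (simp add: z_def)
  define I where "I = {..<n} \<times> (UNIV :: bool set)"
  have "infinite (ball x \<theta>)" for x :: 'a by (rule atlas_infinite_ball[OF A \<theta>(1)])
  then obtain c where c: "inj_on c I" "\<And>i b. i < n \<Longrightarrow> dist (c (i, b)) (z i) < \<theta>"
    using distinct_points_nearby[of \<theta> I "\<lambda>p. z (fst p)"] by (auto simp: I_def)
  have step: "dist (f (c (i, b))) (c (Suc i mod n, b)) < \<eta>" if i: "i < n" for i b
  proof -
    have "dist (f (c (i, b))) (z (Suc i)) < \<eta> / 3"
      unfolding zS[symmetric] using c(2)[OF i, of b] by (intro \<theta>0(2)) (simp add: \<theta>_def)
    moreover have "dist (z (Suc i)) (z (Suc i mod n)) < \<eta> / 3"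
    proof (cases "Suc i = n")
      case True
      then show ?thesis using zn by simp
    next
      case False
      then show ?thesis using i \<eta>(1) by simp
    qed
    moreover have "dist (z (Suc i mod n)) (c (Suc i mod n, b)) < \<eta> / 3"
      using c(2)[of "Suc i mod n" b] n \<theta>(2) by (simp add: dist_commute)
    ultimately show ?thesis
      using dist_triangle[of "f (c (i, b))" "c (Suc i mod n, b)" "z (Suc i)"]
        dist_triangle[of "z (Suc i)" "c (Suc i mod n, b)" "z (Suc i mod n)"] by linarith
  qed
  define T where "T x = (case inv_into I c x of (i, b) \<Rightarrow> c (Suc i mod n, b))" for x
  have T: "T (c (i, b)) = c (Suc i mod n, b)" if "i < n" for i b
    using inv_into_f_f[OF c(1), of "(i, b)"] that by (simp add: T_def I_def)
  have cells: "\<exists>W. convex_cell TYPE(real ^ 'n) W \<and> f p \<in> W \<and> T p \<in> W \<and> (\<forall>x\<in>W. \<forall>y\<in>W. dist x y < e)"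
    if p: "p \<in> c ` I" for p
  proof -
    obtain i b where "i < n" "p = c (i, b)" using p by (auto simp: I_def)
    then show ?thesis using two[OF step[of i b]] T[of i b] unfolding \<C>_def by auto
  qed
  have fin: "finite (c ` I)" by (simp add: I_def)
  from retarget_finite[OF f e zero_less_one fin cells]
  obtain g \<delta> where g: "continuous_on UNIV g" "0 < \<delta>" "\<And>p x. p \<in> c ` I \<Longrightarrow> dist p x < \<delta> \<Longrightarrow> g x = T p"
      "\<And>x. dist (g x) (f x) < e"
    by blast
  have g_c: "g x = c (Suc i mod n, b)" if "i < n" "dist (c (i, b)) x < \<delta>" for i b x
    using g(3)[of "c (i, b)" x] T[of i b] that by (auto simp: I_def)
  obtain d where d: "0 < d" "\<And>x. x \<in> c ` I \<Longrightarrow> x \<noteq> c (0, False) \<Longrightarrow> d \<le> dist (c (0, False)) x"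
    using finite_set_avoid[OF fin, of "c (0, False)"] by blast
  have sep: "d \<le> dist (c (0, False)) (c (i, True))" if "i < n" for i
    using inj_onD[OF c(1), of "(i, True)" "(0, False)"] that n by (intro d(2)) (auto simp: I_def)
  \<comment> \<open>small enough for retargeting and for balls about points of different cycles to be disjoint\<close>
  define \<rho> where "\<rho> = min \<delta> d / 3"
  have \<rho>: "0 < \<rho>" "\<rho> < \<delta>" "2 * \<rho> < d" using g(2) d(1) by (auto simp: \<rho>_def min_def)
  have iter: "(g ^^ Suc i) x = c (Suc i mod n, b)" if "x \<in> cball (c (0, b)) \<rho>" for i b x
    by (rule retargeted_cycle_funpow[where c = "\<lambda>i. c (i, b)" and \<delta> = \<delta>])
      (use n g_c that \<rho> g(2) in auto)
  have block: "attracting_block g n (cball (c (0, b)) \<rho>) (ball (c (0, b)) \<rho>)" for b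
    using n \<rho>(1) iter[of _ b "n - 1"] by (auto simp: attracting_block_def)
  have disj: "(g ^^ i) ` cball (c (0, True)) \<rho> \<subseteq> - cball (c (0, False)) \<rho>" if i: "i < n" for i
  proof (cases i)
    case 0
    have False if "dist (c (0, True)) x \<le> \<rho>" "dist (c (0, False)) x \<le> \<rho>" for x
      using that sep[OF n] \<rho>(3) dist_triangle[of "c (0, False)" "c (0, True)" x]
      by (simp add: dist_commute)
    then show ?thesis using 0 by auto
  next
    case (Suc k)
    have "\<not> dist (c (0, False)) (c (i, True)) \<le> \<rho>"
      using sep[OF i] \<rho>(1,3) by simp
    then show ?thesis
      using iter[of _ True k] i unfolding Suc by auto
  qed
  have "two_disjoint_blocks g n (cball (c (0, True)) \<rho>) (ball (c (0, True)) \<rho>)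
      (cball (c (0, False)) \<rho>) (ball (c (0, False)) \<rho>)"
    unfolding two_disjoint_blocks_def using block disj by blast
  with g(1,4) show ?thesis by blast
qed

section \<open>An attracting block for homeomorphisms\<close>

text \<open>
  Multiplying the distance from \<open>v\<close> by a high power of its ratio to \<open>\<rho>\<close> squeezes the ball of radius
  \<open>R\<close> as much as desired. The truncation by 1 turns this into the identity beyond \<open>\<rho>\<close>.
\<close>

lemma radial_contraction:
  fixes v :: "'b::real_normed_vector"
  assumes R: "0 < R" "R < \<rho>" and r: "0 < r"
  obtains H where "continuous_on UNIV H" "bij H" "\<And>x. \<rho> \<le> dist v x \<Longrightarrow> H x = x"
    "\<And>x. dist v x \<le> R \<Longrightarrow> dist v (H x) < r"
proof -
  have "(\<lambda>k. R * (R / \<rho>) ^ k) \<longlonglongrightarrow> R * 0"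
    using R by (intro tendsto_mult tendsto_const LIMSEQ_power_zero) simp
  then have "\<forall>\<^sub>F k in sequentially. R * (R / \<rho>) ^ k < r"
    using r by (intro order_tendstoD(2)) auto
  then obtain k where k: "R * (R / \<rho>) ^ k < r" by (auto simp: eventually_sequentially)
  define s where "s t = (min 1 (t / \<rho>)) ^ k" for t
  define H where "H x = v + s (dist v x) *\<^sub>R (x - v)" for x
  define \<tau> where "\<tau> t = t * s t" for t
  have \<rho>: "0 < \<rho>" using R by simp
  have s_pos: "0 < s t" if "0 < t" for t using that \<rho> by (simp add: s_def)
  have s_mono: "s t \<le> s t'" if "0 \<le> t" "t \<le> t'" for t t'
    unfolding s_def using that \<rho> by (intro power_mono min.mono divide_right_mono) auto
  have s1: "s t = 1" if "\<rho> \<le> t" for t using that \<rho> by (simp add: s_def)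
  have norm_H: "dist v (H x) = \<tau> (dist v x)" for x
    by (simp add: H_def \<tau>_def dist_norm s_def norm_minus_commute \<rho> less_imp_le abs_mult)
  have \<tau>_less: "\<tau> t < \<tau> t'" if "0 \<le> t" "t < t'" for t t'
  proof -
    have "\<tau> t \<le> t * s t'" unfolding \<tau>_def using that s_mono by (intro mult_left_mono) auto
    also have "\<dots> < \<tau> t'" unfolding \<tau>_def using that s_pos by (intro mult_strict_right_mono) auto
    finally show ?thesis .
  qed
  show thesis
  proof (rule that[of H])
    show "continuous_on UNIV H"
      unfolding H_def s_def by (intro continuous_intros) (use \<rho> in auto)
    show "bij H"
    proof (rule bijI)
      show "inj H"
      proof (rule injI)
        fix x y assume eq: "H x = H y"
        then have \<tau>_eq: "\<tau> (dist v x) = \<tau> (dist v y)" using norm_H by metis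
        have d: "dist v x = dist v y"
        proof (cases "dist v x" "dist v y" rule: linorder_cases)
          case less
          then show ?thesis using \<tau>_less[of "dist v x" "dist v y"] \<tau>_eq by simp
        next
          case greater
          then show ?thesis using \<tau>_less[of "dist v y" "dist v x"] \<tau>_eq by simp
        qed
        show "x = y"
        proof (cases "dist v x = 0")
          case False
          then have "s (dist v x) \<noteq> 0" using s_pos[of "dist v x"] by (simp add: less_le)
          then show ?thesis using eq d by (simp add: H_def)
        qed (use d in auto)
      qed
      show "surj H"
      proof -
        have "\<exists>x. H x = u" for u
        proof (cases "u = v")
          case True
          then show ?thesis by (intro exI[of _ v]) (simp add: H_def)
        next
          case False
          define l where "l = dist v u"
          have l: "0 < l" using False by (simp add: l_def dist_commute)
          have "continuous_on {0..l + \<rho>} \<tau>"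
            unfolding \<tau>_def s_def by (intro continuous_intros) (use \<rho> in auto)
          moreover have "\<tau> 0 \<le> l" "l \<le> \<tau> (l + \<rho>)"
            using l \<rho> s1[of "l + \<rho>"] by (auto simp: \<tau>_def)
          ultimately obtain t where t: "0 \<le> t" "\<tau> t = l"
            using IVT'[of \<tau> 0 l "l + \<rho>"] l \<rho> by auto
          define x where "x = v + (t / l) *\<^sub>R (u - v)"
          have "dist v x = t"
            using t(1) l by (simp add: x_def dist_norm l_def norm_minus_commute)
          then have "H x = v + (s t * (t / l)) *\<^sub>R (u - v)" by (simp add: H_def x_def)
          also have "s t * (t / l) = 1" using t(2) l by (simp add: \<tau>_def field_simps)
          finally show ?thesis by auto
        qed
        then show ?thesis unfolding surj_def by metis
      qed
    qed
    show "H x = x" if "\<rho> \<le> dist v x" for x using s1[OF that] by (simp add: H_def)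
    show "dist v (H x) < r" if "dist v x \<le> R" for x
    proof -
      have "\<tau> (dist v x) \<le> \<tau> R"
        using \<tau>_less[of "dist v x" R] that by (cases "dist v x = R") auto
      also have "\<tau> R < r" using k R by (simp add: \<tau>_def s_def)
      finally show ?thesis by (simp add: norm_H)
    qed
  qed
qed

text \<open>
  The contraction is transported to the cell \<open>W\<close> and extended by the identity. It is supported in a
  compact subset of \<open>W\<close>, which makes the extension continuous, and a continuous bijection of a
  compact space is a homeomorphism.
\<close>

lemma cell_contraction:
  fixes W :: "'a::metric_space set" and v :: "'b::euclidean_space"
  assumes K: "compact (UNIV :: 'a set)" and W: "open W" and \<theta>: "homeomorphism W UNIV \<theta> \<theta>'"
    and R: "0 < R" "R < \<rho>" and r: "0 < r"
  obtains h h' where "homeomorphism UNIV UNIV h h'" "\<And>x. x \<notin> \<theta>' ` cball v \<rho> \<Longrightarrow> h x = x"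
    "\<And>x. x \<in> W \<Longrightarrow> h x \<in> W" "h ` \<theta>' ` cball v R \<subseteq> \<theta>' ` ball v r"
proof -
  obtain H where H: "continuous_on UNIV H" "bij H" "\<And>x. \<rho> \<le> dist v x \<Longrightarrow> H x = x"
      "\<And>x. dist v x \<le> R \<Longrightarrow> dist v (H x) < r"
    using radial_contraction[OF R r, of v] by blast
  have \<theta>1: "\<theta>' (\<theta> x) = x" if "x \<in> W" for x using homeomorphism_apply1[OF \<theta> that] .
  have \<theta>2: "\<theta> (\<theta>' u) = u" for u using homeomorphism_apply2[OF \<theta>] by simp
  have \<theta>'W: "\<theta>' u \<in> W" for u using \<theta> by (auto simp: homeomorphism_def)
  have c: "continuous_on W \<theta>" "continuous_on UNIV \<theta>'" using \<theta> by (auto simp: homeomorphism_def)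
  define h where "h x = (if x \<in> W then \<theta>' (H (\<theta> x)) else x)" for x
  have id: "h x = x" if "x \<notin> \<theta>' ` cball v \<rho>" for x
  proof (cases "x \<in> W")
    case True
    then have "\<theta> x \<notin> cball v \<rho>" using \<theta>1 that by force
    then show ?thesis using H(3)[of "\<theta> x"] True \<theta>1 by (simp add: h_def)
  qed (simp add: h_def)
  have hW: "h x \<in> W \<longleftrightarrow> x \<in> W" for x using \<theta>'W by (simp add: h_def)
  have "compact (\<theta>' ` cball v \<rho>)"
    by (intro compact_continuous_image continuous_on_subset[OF c(2)]) auto
  then have op: "open (- (\<theta>' ` cball v \<rho>))" by (simp add: compact_imp_closed open_Compl)
  have "continuous_on W (\<lambda>x. \<theta>' (H (\<theta> x)))"
    by (rule continuous_on_compose2[OF c(2) continuous_on_compose2[OF H(1) c(1)]]) auto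
  then have c1: "continuous_on W h" by (rule continuous_on_eq) (simp add: h_def)
  have c2: "continuous_on (- (\<theta>' ` cball v \<rho>)) h"
    by (rule continuous_on_eq[OF continuous_on_id]) (simp add: id)
  have "W \<union> - (\<theta>' ` cball v \<rho>) = UNIV" using \<theta>'W by auto
  then have cont: "continuous_on UNIV h" using continuous_on_open_Un[OF W op c1 c2] by simp
  have inj: "inj h"
  proof (rule injI)
    fix x y assume eq: "h x = h y"
    show "x = y"
    proof (cases "x \<in> W")
      case True
      then have "y \<in> W" using hW eq by metis
      then have "\<theta> (\<theta>' (H (\<theta> x))) = \<theta> (\<theta>' (H (\<theta> y)))" using eq True by (simp add: h_def)
      then have "\<theta> x = \<theta> y" using H(2) by (simp add: \<theta>2 bij_def inj_eq)
      then show ?thesis using \<theta>1 True \<open>y \<in> W\<close> by metis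
    next
      case False
      then have "y \<notin> W" using hW eq by metis
      then show ?thesis using eq False by (simp add: h_def)
    qed
  qed
  have surj: "range h = UNIV"
  proof -
    have "\<exists>x. h x = y" for y
    proof (cases "y \<in> W")
      case True
      obtain u where u: "\<theta> y = H u" using surjD[OF bij_is_surj[OF H(2)], of "\<theta> y"] by blast
      have "h (\<theta>' u) = \<theta>' (\<theta> y)" using \<theta>'W u by (simp add: h_def \<theta>2)
      then show ?thesis using \<theta>1[OF True] by auto
    next
      case False
      then show ?thesis by (intro exI[of _ y]) (simp add: h_def)
    qed
    then show ?thesis unfolding surj_def by metis
  qed
  obtain h' where "homeomorphism UNIV UNIV h h'"
    using homeomorphism_compact[OF K cont surj inj] by blast
  then show thesis
  proof (rule that)
    show "h ` \<theta>' ` cball v R \<subseteq> \<theta>' ` ball v r"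
      using H(4) \<theta>2 \<theta>'W by (auto simp: h_def)
  qed (use id hW in auto)
qed

text \<open>
  The orbit of an interior point consists of interior points and accumulates somewhere, so some orbit
  point \<open>y\<close> returns to a small Euclidean cell \<open>W\<close> that contains it; let \<open>n\<close> be the first return
  time. The contraction \<open>h\<close> is centred at \<open>y\<close> and its support is large enough to reach the return
  point. A small ball \<open>B\<close> about \<open>y\<close> avoids this support at the times strictly between 0 and \<open>n\<close>;
  at time \<open>n\<close> it is squeezed into its own interior. How much \<open>f ^^ n\<close> expands \<open>B\<close> is irrelevant, because the strength of the
  contraction is chosen after \<open>B\<close>.
\<close>

lemma dense_proper_block:
  fixes \<A> :: "('a::metric_space, 'n::finite) chart set" and f :: "'a \<Rightarrow> 'a"
  assumes K: "compact (UNIV :: 'a set)" and A: "C1_atlas \<A>"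
    and fg: "homeomorphism UNIV UNIV f g" and e: "0 < e"
  shows "\<exists>f' g'. homeomorphism UNIV UNIV f' g' \<and> (\<forall>x. dist (f' x) (f x) < e) \<and>
    (\<forall>x. dist (g' x) (g x) < e) \<and> (\<exists>n B U p. proper_block f' n B U p)"
proof -
  have f: "continuous_on UNIV f" and g: "continuous_on UNIV g"
    using fg by (auto simp: homeomorphism_def)
  obtain c where c: "0 < c" "\<And>x y. dist x y < c \<Longrightarrow> dist (g x) (g y) < e"
    using compact_uniform_modulus[OF K g e] by blast
  define e' where "e' = min c e / 2"
  have e': "0 < e'" "2 * e' \<le> c" "2 * e' \<le> e" using c(1) e by (auto simp: e'_def)
  fix w0 :: 'a
  obtain V0' V0 where "open V0'" "w0 \<in> V0'" "V0' \<subseteq> ball w0 1" and V0: "open V0" and "V0 \<subseteq> V0'"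
      and V0h: "V0 homeomorphic (UNIV :: (real ^ 'n) set)"
      and "V0' \<inter> euclidean_points TYPE('n) \<subseteq> V0"
    by (rule atlas_euclidean_cell[OF A zero_less_one])
  have "V0 \<noteq> {}" using V0h by (auto simp: homeomorphic_empty)
  then obtain z where "z \<in> V0" by blast
  then have z: "z \<in> euclidean_points TYPE('n)"
    using homeomorphic_UNIV_euclidean_points[OF V0 V0h] by blast
  have orbit: "(f ^^ k) z \<in> euclidean_points TYPE('n)" for k
    by (induction k) (auto simp: z intro: euclidean_points_homeomorphism[OF fg])
  obtain w where w: "\<And>V. open V \<Longrightarrow> w \<in> V \<Longrightarrow> \<exists>j k. j < k \<and> (f ^^ j) z \<in> V \<and> (f ^^ k) z \<in> V"
    using recurrent_accumulation_point[OF K, of f z] by blast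
  obtain W' W where W': "open W'" "w \<in> W'" "W' \<subseteq> ball w e'" and W: "open W" "W \<subseteq> W'"
      and Wh: "W homeomorphic (UNIV :: (real ^ 'n) set)"
      and WI: "W' \<inter> euclidean_points TYPE('n) \<subseteq> W"
    by (rule atlas_euclidean_cell[OF A e'(1)])
  obtain j k where jk: "j < k" "(f ^^ j) z \<in> W'" "(f ^^ k) z \<in> W'"
    using w[OF W'(1,2)] by blast
  define y where "y = (f ^^ j) z"
  have y: "y \<in> W" using jk WI orbit by (auto simp: y_def)
  have "(f ^^ (k - j)) y = (f ^^ (k - j + j)) z"
    unfolding y_def by (simp only: funpow_add comp_apply)
  then have ret: "0 < k - j \<and> (f ^^ (k - j)) y \<in> W"
    using jk WI orbit[of k] by auto
  define n where "n = (LEAST m. 0 < m \<and> (f ^^ m) y \<in> W)"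
  have n: "0 < n" "(f ^^ n) y \<in> W"
    unfolding n_def using LeastI[of "\<lambda>m. 0 < m \<and> (f ^^ m) y \<in> W", OF ret] by auto
  have first: "(f ^^ i) y \<notin> W" if "0 < i" "i < n" for i
    using not_less_Least[of i "\<lambda>m. 0 < m \<and> (f ^^ m) y \<in> W"] that by (auto simp: n_def)
  obtain \<theta> \<theta>' where \<theta>: "homeomorphism W (UNIV :: (real ^ 'n) set) \<theta> \<theta>'"
    using Wh by (auto simp: homeomorphic_def)
  have \<theta>1: "\<theta>' (\<theta> x) = x" if "x \<in> W" for x using homeomorphism_apply1[OF \<theta> that] .
  have \<theta>'W: "\<theta>' u \<in> W" for u using \<theta> by (auto simp: homeomorphism_def)
  have c\<theta>': "continuous_on UNIV \<theta>'" using \<theta> by (auto simp: homeomorphism_def)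
  have op\<theta>': "open (\<theta>' ` T)" if "open T" for T
  proof -
    have "openin (top_of_set W) (\<theta>' ` T)"
      using that by (intro homeomorphism_imp_open_map[OF homeomorphism_sym[THEN iffD1, OF \<theta>]]) auto
    then show ?thesis using W(1) openin_open_trans by blast
  qed
  have cl\<theta>': "closed (\<theta>' ` cball u a)" for u a
    by (intro compact_imp_closed compact_continuous_image continuous_on_subset[OF c\<theta>']) auto
  define v where "v = \<theta> y"
  define R where "R = dist v (\<theta> ((f ^^ n) y)) + 1"
  define \<rho> where "\<rho> = R + 1"
  have R: "0 < R" "R < \<rho>" by (auto simp: R_def \<rho>_def add_nonneg_pos)
  \<comment> \<open>a point that the block orbit will miss\<close>
  have "infinite (ball w0 1)" by (rule atlas_infinite_ball[OF A zero_less_one])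
  then have "infinite (ball w0 1 - (\<lambda>i. (f ^^ i) y) ` {..<n})" by simp
  then obtain p where "p \<notin> (\<lambda>i. (f ^^ i) y) ` {..<n}" using infinite_imp_nonempty by blast
  then have p: "(f ^^ i) y \<noteq> p" if "i < n" for i using that by blast
  \<comment> \<open>the initial conditions whose orbits behave like that of \<open>y\<close> up to time \<open>n\<close>\<close>
  define E where "E = (f ^^ n) -` (\<theta>' ` ball v R) \<inter> (\<Inter>i\<in>{..<n}. (f ^^ i) -` (- {p})) \<inter>
      (\<Inter>i\<in>{0<..<n}. (f ^^ i) -` (- (\<theta>' ` cball v \<rho>)))"
  have "open E"
    unfolding E_def
    by (intro open_Int open_INT ballI open_vimage op\<theta>' continuous_on_funpow[OF f] open_Compl cl\<theta>') auto
  have "(f ^^ n) y \<in> \<theta>' ` ball v R"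
    using \<theta>1[OF n(2)] by (intro image_eqI[of _ _ "\<theta> ((f ^^ n) y)"]) (auto simp: R_def)
  moreover have "(f ^^ i) y \<notin> \<theta>' ` cball v \<rho>" if "0 < i" "i < n" for i
    using first[OF that] \<theta>'W by (metis imageE)
  ultimately have yE: "y \<in> E"
    unfolding E_def using p by simp
  have "openin (top_of_set W) (W \<inter> E)" using \<open>open E\<close> by (simp add: openin_open_Int)
  then have "open (\<theta> ` (W \<inter> E))" using homeomorphism_imp_open_map[OF \<theta>] by simp
  moreover have "v \<in> \<theta> ` (W \<inter> E)" using y yE by (simp add: v_def)
  ultimately obtain r where r: "0 < r" "cball v r \<subseteq> \<theta> ` (W \<inter> E)"
    using open_contains_cball by blast
  define B where "B = \<theta>' ` cball v r"
  define U where "U = \<theta>' ` ball v r"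
  have BE: "B \<subseteq> E"
  proof
    fix x assume "x \<in> B"
    then obtain x' where "x = \<theta>' (\<theta> x')" "x' \<in> W \<inter> E" using r(2) unfolding B_def by blast
    then show "x \<in> E" using \<theta>1 by auto
  qed
  have B_ret: "(f ^^ n) x \<in> \<theta>' ` ball v R"
    and B_p: "i < n \<Longrightarrow> (f ^^ i) x \<noteq> p"
    and B_out: "0 < i \<Longrightarrow> i < n \<Longrightarrow> (f ^^ i) x \<notin> \<theta>' ` cball v \<rho>" if "x \<in> B" for x i
  proof -
    have x: "x \<in> E" using that BE by blast
    show "(f ^^ n) x \<in> \<theta>' ` ball v R" using x by (simp add: E_def)
    show "(f ^^ i) x \<noteq> p" if "i < n" using x that by (simp add: E_def)
    show "(f ^^ i) x \<notin> \<theta>' ` cball v \<rho>" if "0 < i" "i < n" using x that by (simp add: E_def)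
  qed
  obtain h h' where h: "homeomorphism UNIV UNIV h h'" "\<And>x. x \<notin> \<theta>' ` cball v \<rho> \<Longrightarrow> h x = x"
      "\<And>x. x \<in> W \<Longrightarrow> h x \<in> W" "h ` \<theta>' ` cball v R \<subseteq> \<theta>' ` ball v r"
    using cell_contraction[OF K W(1) \<theta> R r(1)] by blast
  have hx: "dist (h x) x < 2 * e'" for x
  proof (cases "x \<in> W")
    case True
    then have "x \<in> ball w e'" "h x \<in> ball w e'" using h(3) W(2) W'(3) by blast+
    then have "dist w x < e'" "dist w (h x) < e'" by auto
    then show ?thesis using dist_triangle[of "h x" x w] by (simp add: dist_commute)
  next
    case False
    then have "x \<notin> \<theta>' ` cball v \<rho>" using \<theta>'W by auto
    then have "h x = x" by (rule h(2))
    then show ?thesis using e'(1) by simp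
  qed
  have iter: "((h \<circ> f) ^^ i) x = (f ^^ i) x" if "x \<in> B" "i < n" for i x
    using that(2)
  proof (induction i)
    case (Suc i)
    have "(f ^^ Suc i) x \<notin> \<theta>' ` cball v \<rho>"
      using B_out[OF that(1) _ Suc.prems] by simp
    then show ?case using Suc h(2)[of "f ((f ^^ i) x)"] by simp
  qed simp
  have ret_B: "((h \<circ> f) ^^ n) x \<in> U" if "x \<in> B" for x
  proof -
    obtain m where m: "n = Suc m" using n(1) gr0_implies_Suc by blast
    have "((h \<circ> f) ^^ n) x = h ((f ^^ n) x)" using iter[OF that, of m] by (simp add: m)
    moreover have "(f ^^ n) x \<in> \<theta>' ` cball v R"
      using B_ret[OF that] by auto
    ultimately show ?thesis using h(4) unfolding U_def by auto
  qed
  show ?thesis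
  proof (intro exI conjI allI)
    show "homeomorphism UNIV UNIV (h \<circ> f) (g \<circ> h')"
      using homeomorphism_compose[OF fg h(1)] .
    show "dist ((h \<circ> f) x) (f x) < e" for x using hx[of "f x"] e'(3) by simp
    show "dist ((g \<circ> h') x) (g x) < e" for x
    proof -
      have "h (h' x) = x" using homeomorphism_apply2[OF h(1)] by simp
      then have "dist (h' x) x < c" using hx[of "h' x"] e'(2) by (simp add: dist_commute)
      then show ?thesis using c(2) by simp
    qed
    have "attracting_block (h \<circ> f) n B U"
      using n(1) cl\<theta>' op\<theta>'[of "ball v r"] r(1) ret_B
      by (auto simp: attracting_block_def B_def U_def)
    moreover have "((h \<circ> f) ^^ i) ` B \<subseteq> - {p}" if "i < n" for i
      using iter[OF _ that] B_p that by auto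
    ultimately show "proper_block (h \<circ> f) n B U p" by (simp add: proper_block_def)
  qed
qed

section \<open>Typical maps\<close>

lemma two_disjoint_blocks_robust:
  fixes f :: "'a::metric_space \<Rightarrow> 'a"
  assumes K: "compact (UNIV :: 'a set)" and f: "continuous_on UNIV f"
    and t: "two_disjoint_blocks f n B W B' W'"
  shows "\<exists>r>0. \<forall>h. (\<forall>x. dist (f x) (h x) < r) \<longrightarrow> two_disjoint_blocks h n B W B' W'"
proof -
  have A: "attracting_block f n B W" "attracting_block f n B' W'"
    and avoid: "\<And>i. i < n \<Longrightarrow> (f ^^ i) ` B \<subseteq> - B'"
    using t by (auto simp: two_disjoint_blocks_def)
  then have cl: "closed B" "closed B'" by (auto simp: attracting_block_def)
  have "\<forall>\<^sub>F \<delta> in at_right 0. \<forall>h. (\<forall>x. dist (f x) (h x) < \<delta>) \<longrightarrow> (\<forall>i<n. (h ^^ i) ` B \<subseteq> - B')"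
    by (rule block_orbit_avoids_robust[OF K f cl]) (rule avoid)
  with attracting_block_robust[OF K f A(1)] attracting_block_robust[OF K f A(2)]
  have "\<forall>\<^sub>F \<delta> in at_right 0. \<forall>h. (\<forall>x. dist (f x) (h x) < \<delta>) \<longrightarrow> two_disjoint_blocks h n B W B' W'"
    unfolding two_disjoint_blocks_def by eventually_elim blast
  then obtain r where "0 < r" "\<forall>h. (\<forall>x. dist (f x) (h x) < r) \<longrightarrow> two_disjoint_blocks h n B W B' W'"
    by (rule eventually_at_right_0_obtain)
  then show ?thesis by blast
qed

lemma proper_block_robust:
  fixes f :: "'a::metric_space \<Rightarrow> 'a"
  assumes K: "compact (UNIV :: 'a set)" and f: "continuous_on UNIV f" and t: "proper_block f n B W p"
  shows "\<exists>r>0. \<forall>h. (\<forall>x. dist (f x) (h x) < r) \<longrightarrow> proper_block h n B W p"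
proof -
  have A: "attracting_block f n B W" and avoid: "\<And>i. i < n \<Longrightarrow> (f ^^ i) ` B \<subseteq> - {p}"
    using t by (auto simp: proper_block_def)
  then have cl: "closed B" "closed {p}" by (auto simp: attracting_block_def)
  have "\<forall>\<^sub>F \<delta> in at_right 0. \<forall>h. (\<forall>x. dist (f x) (h x) < \<delta>) \<longrightarrow> (\<forall>i<n. (h ^^ i) ` B \<subseteq> - {p})"
    by (rule block_orbit_avoids_robust[OF K f cl]) (rule avoid)
  with attracting_block_robust[OF K f A]
  have "\<forall>\<^sub>F \<delta> in at_right 0. \<forall>h. (\<forall>x. dist (f x) (h x) < \<delta>) \<longrightarrow> proper_block h n B W p"
    unfolding proper_block_def by eventually_elim blast
  then obtain r where "0 < r" "\<forall>h. (\<forall>x. dist (f x) (h x) < r) \<longrightarrow> proper_block h n B W p"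
    by (rule eventually_at_right_0_obtain)
  then show ?thesis by blast
qed

lemma typical_two_disjoint_blocks:
  fixes \<A> :: "('a::metric_space, 'n::finite) chart set"
  assumes K: "compact (UNIV :: 'a set)" and A: "C1_atlas \<A>"
  shows "typical continuous_maps
    (\<lambda>f :: 'a \<Rightarrow> 'a. continuous_on UNIV f \<and> (\<exists>n B W B' W'. two_disjoint_blocks f n B W B' W'))"
    (is "typical _ ?P")
  unfolding continuous_maps_def
proof (rule typicalI[where G = "Collect ?P"])
  show "Metric_space {f :: 'a \<Rightarrow> 'a. continuous_on UNIV f} sup_dist" by (rule sup_dist_metric[OF K])
next
  fix f :: "'a \<Rightarrow> 'a" assume "f \<in> Collect ?P"
  then obtain n B W B' W' where f: "continuous_on UNIV f" and t: "two_disjoint_blocks f n B W B' W'" by blast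
  obtain r where r: "0 < r" "\<And>h. (\<forall>x. dist (f x) (h x) < r) \<Longrightarrow> two_disjoint_blocks h n B W B' W'"
    using two_disjoint_blocks_robust[OF K f t] by blast
  have "two_disjoint_blocks h n B W B' W'" if "sup_dist f h < r" for h
    by (intro r(2) allI le_less_trans[OF sup_dist_ge[OF K] that])
  then show "\<exists>r>0. \<forall>h\<in>{f. continuous_on UNIV f}. sup_dist f h < r \<longrightarrow> h \<in> Collect ?P"
    using r(1) by blast
next
  fix f :: "'a \<Rightarrow> 'a" and e :: real assume "f \<in> {f. continuous_on UNIV f}" "0 < e"
  then have f: "continuous_on UNIV f" and e: "0 < e / 2" by auto
  obtain h where h: "continuous_on UNIV h" "\<And>x. dist (h x) (f x) < e / 2"
      "\<exists>n B W B' W'. two_disjoint_blocks h n B W B' W'"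
    using dense_two_disjoint_blocks[OF K A f e] by blast
  have "sup_dist f h < e"
    using \<open>0 < e\<close> h(2) by (intro sup_dist_less) (simp_all add: dist_commute)
  then show "\<exists>h\<in>Collect ?P. sup_dist f h < e"
    using h(1,3) by blast
qed auto

lemma typical_proper_block:
  fixes \<A> :: "('a::metric_space, 'n::finite) chart set"
  assumes K: "compact (UNIV :: 'a set)" and A: "C1_atlas \<A>"
  shows "typical homeomorphisms
    (\<lambda>f :: 'a \<Rightarrow> 'a. (\<exists>g. homeomorphism UNIV UNIV f g) \<and> (\<exists>n B W p. proper_block f n B W p))"
    (is "typical _ ?P")
  unfolding homeomorphisms_def
proof (rule typicalI[where G = "Collect ?P"])
  show "Metric_space {f :: 'a \<Rightarrow> 'a. \<exists>h. homeomorphism UNIV UNIV f h} homeo_dist"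
    by (rule homeo_dist_metric[OF K])
next
  fix f :: "'a \<Rightarrow> 'a" assume "f \<in> Collect ?P"
  then obtain n B W p g where fg: "homeomorphism UNIV UNIV f g" and t: "proper_block f n B W p" by blast
  then have f: "continuous_on UNIV f" by (simp add: homeomorphism_def)
  obtain r where r: "0 < r" "\<And>h. (\<forall>x. dist (f x) (h x) < r) \<Longrightarrow> proper_block h n B W p"
    using proper_block_robust[OF K f t] by blast
  have "proper_block h n B W p" if "homeo_dist f h < r" for h
  proof -
    have "sup_dist f h < r" using that by (simp add: homeo_dist_def)
    then show ?thesis by (intro r(2) allI le_less_trans[OF sup_dist_ge[OF K]])
  qed
  then show "\<exists>r>0. \<forall>h\<in>{f. \<exists>h. homeomorphism UNIV UNIV f h}. homeo_dist f h < r \<longrightarrow> h \<in> Collect ?P"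
    using r(1) by blast
next
  fix f :: "'a \<Rightarrow> 'a" and e :: real
  assume "f \<in> {f. \<exists>h. homeomorphism UNIV UNIV f h}" "0 < e"
  then obtain g where fg: "homeomorphism UNIV UNIV f g" and e: "0 < e / 2" by auto
  obtain f' g' where f': "homeomorphism UNIV UNIV f' g'"
      "\<And>x. dist (f' x) (f x) < e / 2" "\<And>x. dist (g' x) (g x) < e / 2"
      "\<exists>n B W p. proper_block f' n B W p"
    using dense_proper_block[OF K A fg e] by blast
  have "inv f = g" "inv f' = g'"
    using fg f'(1) by (auto simp: homeomorphism_def intro!: inv_equality)
  then have "homeo_dist f f' < e"
    using f'(2,3) \<open>0 < e\<close> unfolding homeo_dist_def
    by (simp add: sup_dist_less dist_commute)
  then show "\<exists>h\<in>Collect ?P. homeo_dist f h < e"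
    using f'(1,4) by blast
qed auto

lemma typical_mono:
  assumes "typical X P" and PQ: "\<And>f. P f \<Longrightarrow> Q f"
  shows "typical X Q"
proof -
  have "{f. P f} \<subseteq> {f. Q f}" using PQ by auto
  then show ?thesis
    using assms(1) unfolding typical_def by (meson order_trans)
qed

theorem theorem2:
  fixes \<A> :: "('a::metric_space, 'n::finite) chart set"
    and g :: "('a, 'n) metric_tensor"
    and vol :: "'a measure"
    and d :: "'a measure \<Rightarrow> 'a measure \<Rightarrow> real"
  assumes "compact (UNIV :: 'a set)"
    and "connected (UNIV :: 'a set)"
    and "C1_atlas \<A>"
    and "riemannian_metric \<A> g"
    and "\<forall>x y. dist x y = riemannian_dist \<A> g x y"
    and "is_riemannian_volume \<A> g vol"
    and "Metric_space prob_measures d"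
    and "Metric_space.mtopology prob_measures d = weak_star"
  shows "typical continuous_maps
           (\<lambda>f. subtopology weak_star (invariant_measures f) interior_of pseudo_physical vol d f = {})
       \<and> typical homeomorphisms
           (\<lambda>f. subtopology weak_star (invariant_measures f) interior_of pseudo_physical vol d f = {})"
proof
  note K = assms(1) and A = assms(3) and d = assms(7,8)
  let ?P = "\<lambda>f. subtopology weak_star (invariant_measures f) interior_of pseudo_physical vol d f = {}"
  show "typical continuous_maps ?P"
  proof (rule typical_mono[OF typical_two_disjoint_blocks[OF K A]])
    fix f :: "'a \<Rightarrow> 'a"
    assume "continuous_on UNIV f \<and> (\<exists>n B W B' W'. two_disjoint_blocks f n B W B' W')"
    then obtain n B W B' W' where f: "continuous_on UNIV f" and t: "two_disjoint_blocks f n B W B' W'"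
      by blast
    show "?P f" by (rule two_disjoint_blocks_empty_interior[OF K d f t])
  qed
  show "typical homeomorphisms ?P"
  proof (rule typical_mono[OF typical_proper_block[OF K A]])
    fix f :: "'a \<Rightarrow> 'a"
    assume "(\<exists>g. homeomorphism UNIV UNIV f g) \<and> (\<exists>n B W p. proper_block f n B W p)"
    then obtain g n B W p where fg: "homeomorphism UNIV UNIV f g" and t: "proper_block f n B W p"
      by blast
    show "?P f" by (rule proper_block_empty_interior[OF K d fg t])
  qed
qed

end
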